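(* For real $s\ge 2$ let $b_s(\cos\theta)=2^{4/(s-1)}\,\dfrac{\beta_s(\theta)}{\sin\theta}\,|\beta_s'(\theta)|$, $\theta\in(0,\pi]$, be the angular part of the Boltzmann collision kernel for the inverse power law potential $U_s(r)=r^{-(s-1)}$, where $\beta_s(\theta)$ is the rescaled impact parameter as a function of the deviation angle $\theta$ (as defined in the context). There exists a real analytic function $\Phi:(0,\infty)\to\mathbb{R}$ such that $$\lim_{s\to\infty} b_s\left(\cos\left(\frac{\psi}{\sqrt{s}}\right)\right)=\Phi(\psi)$$ locally uniformly for $\psi\in(0,\infty)$ (i.e. uniformly on compact subsets of $(0,\infty)$), and such that $$\lim_{\psi\to\infty}\Phi(\psi)=\frac14 .$$ Furthermore, $$\Phi(\psi)=\frac{1}{\psi^2}+\frac{1}{\sqrt{\pi}}\,\frac1\psi+\Phi_0(\psi),\qquad \psi\in(0,\infty),$$ where $\Phi_0:[0,\infty)\to\mathbb{R}$ is continuous.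
   Context: Definition of $\beta_s(\theta)$. Fix $s\ge2$. For $\beta>0$ let $x_0=x_0(\beta)\in(0,1)$ be the positive root of $1-x^2-(x/\beta)^{s-1}=0$, and set $$\varphi_0(\beta)=\int_0^{x_0(\beta)}\frac{dy}{\sqrt{1-y^2-(y/\beta)^{s-1}}},\qquad \theta(\beta)=\pi-2\varphi_0(\beta).$$ Equivalently, substituting $y=x_0z$, one has $\varphi_0=\varphi_s(x_0)$ with $$\varphi_s(x)=x\int_0^1\frac{dz}{\sqrt{1-z^{s-1}-x^2(z^2-z^{s-1})}},\qquad x\in[0,1),$$ and $\beta=x_0(1-x_0^2)^{-1/(s-1)}$. With $x_0(0)=0$, the maps $\beta\mapsto x_0(\beta)$ and $x\mapsto\varphi_s(x)$ are strictly increasing bijections $[0,\infty)\to[0,1)$ and $[0,1)\to[0,\pi/2)$. Hence $\beta\mapsto\theta(\beta)$ is a strictly decreasing bijection from $[0,\infty)$ onto $(0,\pi]$; its inverse is denoted $\theta\mapsto\beta_s(\theta)$, and $\beta_s'$ is its derivative with respect to $\theta$. At $\theta=\pi$ (where $\beta_s(\pi)=0$ and $\sin\pi=0$) the value $b_s(\cos\theta)$ is understood as the continuous extension from $\theta<\pi$. For fixed $\psi>0$, $b_s(\cos(\psi/\sqrt s))$ means $b_s(\cos\theta)$ at $\theta=\psi/\sqrt s$, which lies in $(0,\pi]$ for all $s$ large enough. *)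

theory Defs
  imports "HOL-Analysis.Analysis"
begin

definition x_zero :: "real \<Rightarrow> real \<Rightarrow> real" where
  "x_zero s \<beta> =
     (if \<beta> = 0 then 0 else (THE x. 0 < x \<and> 1 - x\<^sup>2 - (x / \<beta>) powr (s - 1) = 0))"

text \<open>
  The integrand below is unbounded at the right endpoint. The gauge integral covers such improper
  integrals; at the endpoint itself the integrand takes the value \<open>1 / 0 = 0\<close>, which
  is irrelevant for the integral.
\<close>

definition phi_zero :: "real \<Rightarrow> real \<Rightarrow> real" where
  "phi_zero s \<beta> =
     integral {0..x_zero s \<beta>} (\<lambda>y. 1 / sqrt (1 - y\<^sup>2 - (y / \<beta>) powr (s - 1)))"

definition deviation_angle :: "real \<Rightarrow> real \<Rightarrow> real" where
  "deviation_angle s \<beta> = pi - 2 * phi_zero s \<beta>"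

text \<open>
  For \<open>s \<ge> 2\<close> the deviation angle is a strictly decreasing bijection from
  \<open>{0..}\<close> onto \<open>{0<..pi}\<close>; only the values of the inverse at angles in
  \<open>{0<..pi}\<close> are meaningful.
\<close>

definition impact_parameter :: "real \<Rightarrow> real \<Rightarrow> real" where
  "impact_parameter s = the_inv_into {0..} (deviation_angle s)"

definition kernel_formula :: "real \<Rightarrow> real \<Rightarrow> real" where
  "kernel_formula s \<theta> =
     2 powr (4 / (s - 1)) * (impact_parameter s \<theta> / sin \<theta>) * \<bar>deriv (impact_parameter s) \<theta>\<bar>"

text \<open>
  The angular kernel is a function of \<open>z = cos \<theta>\<close> for \<open>z \<in> {-1..<1}\<close>,
  i.e. \<open>\<theta> = arccos z \<in> {0<..pi}\<close>. At \<open>z = -1\<close> the formula degenerates and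
  the value is the limit from \<open>\<theta> < pi\<close>.
\<close>

definition angular_kernel :: "real \<Rightarrow> real \<Rightarrow> real" where
  "angular_kernel s z =
     (if z = -1 then Lim (at_left pi) (kernel_formula s) else kernel_formula s (arccos z))"

text \<open>
  The library predicate \<open>analytic_on\<close> is for functions on the complex numbers, so real
  analyticity is defined by local power series expansions. It is meant for open \<open>S\<close>.
\<close>

definition real_analytic_on :: "(real \<Rightarrow> real) \<Rightarrow> real set \<Rightarrow> bool" where
  "real_analytic_on f S \<longleftrightarrow>
     (\<forall>x\<in>S. \<exists>a r. 0 < r \<and> (\<forall>y\<in>ball x r. (\<lambda>n. a n * (y - x) ^ n) sums f y))"

end

theory Submission imports Defs "HOL-Complex_Analysis.Complex_Analysis" "HOL-Real_Asymp.Real_Asymp"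
begin

text \<open>
  Put \<open>n = s - 1\<close>, let \<open>x\<close> be the root \<open>x_zero s \<beta>\<close>, and let \<open>w = n (1 / x\<^sup>2 - 1)\<close>. The
  substitution \<open>y = x exp (- t / n)\<close> in the integral defining the deflection angle shows that
  this angle equals \<open>psi n w / sqrt n\<close>, where

  \<open>psi n w = 2 * \<integral> p^(-1/2) - (p + w m)^(-1/2)\<close> over \<open>t > 0\<close>, with
  \<open>p = n (exp (2 t / n) - 1)\<close> and \<open>m = exp (2 t / n) (1 - exp (-t))\<close>

  (\<open>deviation_angle_eq\<close>). So angles of order \<open>1 / sqrt s\<close> correspond to \<open>w\<close> of order one,
  and as \<open>n\<close> grows the weights converge to \<open>2 t\<close> and \<open>1 - exp (-t)\<close>. For bounded \<open>w\<close> the integrands have an integrable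
  majorant independent of \<open>n\<close>, hence \<open>psi n\<close> and its derivative converge to the function
  \<open>psi\<close> with the limiting weights and to its derivative (\<open>fin_psi_tendsto\<close>). The impact parameter is an elementary
  function of \<open>w\<close> and \<open>n\<close>, so the kernel at the angle \<open>psi n w / sqrt n\<close> is explicit
  (\<open>kernel_formula_eq\<close>), and in the limit it becomes

  \<open>\<Phi> (psi w) = (w + 2) / (2 * w * psi w * psi' w)\<close>.

  Since \<open>psi\<close> is strictly increasing from \<open>0\<close> to infinity, this defines \<open>\<Phi>\<close> on all positive reals.
  Convergence is shown along sequences in which exponent and angle vary simultaneously, which is
  equivalent to local uniformity.

  Analyticity of \<open>\<Phi>\<close> holds because \<open>psi\<close> extends holomorphically to the half plane of real part above \<open>-1\<close>
  and has positive derivative on the real axis. For large \<open>w\<close>, scaling \<open>t\<close> by \<open>w\<close> shows that \<open>psi' w\<close> behaves like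
  \<open>1 / sqrt w\<close> and \<open>psi w\<close> like \<open>2 sqrt w\<close>, which gives the hard sphere value \<open>1/4\<close>. Near
  \<open>w = 0\<close> one has \<open>psi w = a w + b w\<^sup>2 + O(w\<^sup>3)\<close>, where Gamma integrals give \<open>a = sqrt (pi / 2)\<close> and
  \<open>b = - sqrt pi / 2 * (1 - 1 / sqrt 2)\<close>. After subtracting \<open>1 / \<psi>\<^sup>2 + k / \<psi>\<close> from \<open>\<Phi>\<close> the singularity at
  \<open>0\<close> disappears exactly when \<open>a - 2 b = 2 k a\<^sup>2\<close>, that is, for \<open>k = 1 / sqrt pi\<close>.
\<close>

section \<open>Parameter integrals\<close>

text \<open>
  An integrable bound on the parameter derivative bounds all difference quotients, by the mean value
  inequality on the convex set \<open>S\<close>, so dominated convergence applies to them.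
\<close>

lemma has_field_derivative_integral_parameter:
  fixes f f' :: "'b \<Rightarrow> complex \<Rightarrow> complex"
  assumes S: "open S" "convex S" "z \<in> S"
    and int: "\<And>x. x \<in> S \<Longrightarrow> integrable M (\<lambda>t. f t x)"
    and der: "\<And>t x. t \<in> space M \<Longrightarrow> x \<in> S \<Longrightarrow> (f t has_field_derivative f' t x) (at x)"
    and bound: "\<And>t x. t \<in> space M \<Longrightarrow> x \<in> S \<Longrightarrow> norm (f' t x) \<le> g t"
    and g: "integrable M g"
    and meas: "(\<lambda>t. f' t z) \<in> borel_measurable M"
  shows "((\<lambda>x. \<integral>t. f t x \<partial>M) has_field_derivative (\<integral>t. f' t z \<partial>M)) (at z)"
proof -
  let ?F = "\<lambda>x. \<integral>t. f t x \<partial>M"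
  have "((\<lambda>x. (?F x - ?F z) / (x - z)) \<longlongrightarrow> (\<integral>t. f' t z \<partial>M)) (at z within S)"
    unfolding tendsto_at_iff_sequentially
  proof (intro allI impI)
    fix X :: "nat \<Rightarrow> complex"
    assume X: "\<forall>i. X i \<in> S - {z}" "X \<longlonglongrightarrow> z"
    define q where "q = (\<lambda>i t. (f t (X i) - f t z) / (X i - z))"
    have "(\<lambda>i. \<integral>t. q i t \<partial>M) \<longlonglongrightarrow> (\<integral>t. f' t z \<partial>M)"
    proof (rule integral_dominated_convergence[where w = g])
      show "AE t in M. (\<lambda>i. q i t) \<longlonglongrightarrow> f' t z"
      proof (rule AE_I2)
        fix t assume "t \<in> space M"
        then have "((\<lambda>x. (f t x - f t z) / (x - z)) \<longlongrightarrow> f' t z) (at z within S)"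
          using der[of t z] S(3) by (simp add: has_field_derivative_iff at_within_open[OF S(3,1)])
        then show "(\<lambda>i. q i t) \<longlonglongrightarrow> f' t z"
          using X unfolding tendsto_at_iff_sequentially q_def o_def by blast
      qed
      show "AE t in M. norm (q i t) \<le> g t" for i
      proof (rule AE_I2)
        fix t assume t: "t \<in> space M"
        have "norm (f t (X i) - f t z) \<le> g t * norm (X i - z)"
        proof (rule field_differentiable_bound[OF S(2)])
          show "(f t has_field_derivative f' t x) (at x within S)" if "x \<in> S" for x
            using der[OF t that] by (rule has_field_derivative_at_within)
        qed (use bound t X S in auto)
        moreover have "norm (X i - z) > 0" using X by auto
        ultimately show "norm (q i t) \<le> g t"
          by (simp add: q_def norm_divide divide_le_eq)
      qed
      show "q i \<in> borel_measurable M" for i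
        unfolding q_def using X S
        by (intro borel_measurable_divide borel_measurable_diff borel_measurable_const
            borel_measurable_integrable int) auto
    qed (use meas g in auto)
    moreover have "(\<integral>t. q i t \<partial>M) = (?F (X i) - ?F z) / (X i - z)" for i
      unfolding q_def using X S by (simp add: int)
    ultimately show "((\<lambda>x. (?F x - ?F z) / (x - z)) \<circ> X) \<longlonglongrightarrow> (\<integral>t. f' t z \<partial>M)"
      by (simp add: o_def)
  qed
  then show ?thesis
    by (simp add: has_field_derivative_iff at_within_open[OF S(3,1)])
qed

lemma norm_powr_of_real: "z \<noteq> 0 \<Longrightarrow> norm (z powr complex_of_real a) = norm z powr a"
  by (simp add: norm_powr_real_powr')

section \<open>Deflection functions as parameter integrals\<close>

text \<open>
  Both the exact deflection angle at a given exponent and its grazing limit have the form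
  \<open>2 * \<integral> p^(-1/2) - (p + w m)^(-1/2)\<close> as functions of a parameter \<open>w\<close>; only the weights
  \<open>p\<close> and \<open>m\<close> differ. The condition \<open>2 m \<le> p\<close> keeps \<open>p + z m\<close> comparable to \<open>p\<close> for
  all complex \<open>z\<close> with real part above \<open>-1\<close>. Up to constants, the weight \<open>m p^(-3/2)\<close> then dominates the
  integrand, for bounded \<open>z\<close>, and all its derivatives in \<open>z\<close>, although neither of the two powers in the integrand
  need be integrable alone.
\<close>

locale deflection =
  fixes M :: "real measure" and p m :: "real \<Rightarrow> real"
  assumes meas_p: "p \<in> borel_measurable M"
    and meas_m: "m \<in> borel_measurable M"
    and m_pos: "t \<in> space M \<Longrightarrow> 0 < m t"
    and m_le_p: "t \<in> space M \<Longrightarrow> 2 * m t \<le> p t"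
    and integrable_weight: "integrable M (\<lambda>t. m t * p t powr (-3/2))"
    and nontrivial: "emeasure M (space M) \<noteq> 0"
begin

lemma p_pos: "t \<in> space M \<Longrightarrow> 0 < p t"
  using m_pos[of t] m_le_p[of t] by linarith

definition psi :: "real \<Rightarrow> real" where
  "psi w = 2 * (\<integral>t. p t powr (-1/2) - (p t + w * m t) powr (-1/2) \<partial>M)"

definition dpsi :: "real \<Rightarrow> real" where
  "dpsi w = (\<integral>t. m t * (p t + w * m t) powr (-3/2) \<partial>M)"

text \<open>
  The holomorphic extensions of \<open>psi\<close> and of its first two derivatives. They give analyticity of the
  inverse function, and the expansion of \<open>psi\<close> at \<open>0\<close>, where \<open>0\<close> is an interior point
  of the complex domain.
\<close>

definition cpsi :: "complex \<Rightarrow> complex" where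
  "cpsi z = 2 * (\<integral>t. complex_of_real (p t powr (-1/2)) -
                    (of_real (p t) + z * of_real (m t)) powr of_real (-1/2) \<partial>M)"

definition cdpsi :: "complex \<Rightarrow> complex" where
  "cdpsi z = (\<integral>t. of_real (m t) * (of_real (p t) + z * of_real (m t)) powr of_real (-3/2) \<partial>M)"

definition cddpsi :: "complex \<Rightarrow> complex" where
  "cddpsi z = -3/2 * (\<integral>t. of_real ((m t)\<^sup>2) * (of_real (p t) + z * of_real (m t)) powr of_real (-5/2) \<partial>M)"

lemma Re_ge:
  assumes "t \<in> space M" "Re z > -1"
  shows "p t / 2 \<le> Re (of_real (p t) + z * of_real (m t))"
proof -
  have "- 1 * m t \<le> Re z * m t"
    using assms m_pos[of t] by (intro mult_right_mono) auto
  then show ?thesis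
    using m_le_p[of t] assms by simp
qed

lemma norm_powr_le:
  assumes "t \<in> space M" "Re z > -1" "a \<ge> 0"
  shows "norm ((of_real (p t) + z * of_real (m t)) powr complex_of_real (-a)) \<le> 2 powr a * p t powr (-a)"
proof -
  let ?u = "complex_of_real (p t) + z * of_real (m t)"
  have u: "p t / 2 \<le> norm ?u"
    using Re_ge[OF assms(1,2)] complex_Re_le_cmod order_trans by blast
  then have "?u \<noteq> 0"
    using p_pos[OF assms(1)] by (intro notI) auto
  then have "norm (?u powr complex_of_real (-a)) = norm ?u powr (-a)"
    by (rule norm_powr_of_real)
  also have "\<dots> \<le> (p t / 2) powr (-a)"
    using u p_pos[OF assms(1)] assms(3) by (intro powr_mono2') auto
  also have "\<dots> = 2 powr a * p t powr (-a)"
    using p_pos[OF assms(1)] by (simp add: powr_divide powr_minus field_simps)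
  finally show ?thesis .
qed

lemma powr_deriv:
  assumes "t \<in> space M" "Re z > -1"
  shows "((\<lambda>z. (of_real (p t) + z * of_real (m t)) powr complex_of_real a) has_field_derivative
           of_real a * of_real (m t) * (of_real (p t) + z * of_real (m t)) powr complex_of_real (a - 1)) (at z)"
proof -
  have "of_real (p t) + z * of_real (m t) \<notin> \<real>\<^sub>\<le>\<^sub>0"
    using Re_ge[OF assms] p_pos[OF assms(1)] by (auto simp: complex_nonpos_Reals_iff)
  then show ?thesis
    by (auto intro!: derivative_eq_intros simp: algebra_simps)
qed

definition half_plane :: "complex set" where "half_plane = {z. Re z > -1}"

lemma half_plane: "open half_plane" "convex half_plane"
  unfolding half_plane_def by (auto simp: open_halfspace_Re_gt convex_halfspace_Re_gt)

lemma meas_powr: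
  "(\<lambda>t. (of_real (p t) + z * of_real (m t)) powr complex_of_real a) \<in> borel_measurable M"
proof -
  note [measurable] = meas_p meas_m
  show ?thesis by measurable
qed

text \<open>
  One more factor \<open>m / p \<le> 1/2\<close> costs nothing, so the same weight also dominates the second derivative.
\<close>

lemma weight_powr:
  assumes "t \<in> space M"
  shows "(m t)\<^sup>2 * p t powr (-5/2) \<le> m t * p t powr (-3/2)"
proof -
  have "(m t)\<^sup>2 * p t powr (-5/2) \<le> m t * p t * p t powr (-5/2)"
    using m_pos[OF assms] m_le_p[OF assms]
    by (intro mult_right_mono) (auto simp: power2_eq_square)
  also have "\<dots> = m t * (p t powr 1 * p t powr (-5/2))"
    using p_pos[OF assms] by simp
  also have "\<dots> = m t * p t powr (-3/2)"
    by (subst powr_add[symmetric]) simp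
  finally show ?thesis .
qed

lemma integrable_cdpsi:
  assumes "z \<in> half_plane"
  shows "integrable M (\<lambda>t. of_real (m t) * (of_real (p t) + z * of_real (m t)) powr complex_of_real (-3/2))"
proof (rule Bochner_Integration.integrable_bound)
  show "integrable M (\<lambda>t. 2 powr (3/2) * (m t * p t powr (-3/2)))"
    using integrable_weight by simp
  show "AE t in M. norm (of_real (m t) * (of_real (p t) + z * of_real (m t)) powr complex_of_real (-3/2))
          \<le> norm (2 powr (3/2) * (m t * p t powr (-3/2)))"
  proof (rule AE_I2)
    fix t assume t: "t \<in> space M"
    show "norm (of_real (m t) * (of_real (p t) + z * of_real (m t)) powr complex_of_real (-3/2))
          \<le> norm (2 powr (3/2) * (m t * p t powr (-3/2)))"
      using norm_powr_le[OF t, of z "3/2"] assms m_pos[OF t]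
      by (simp add: half_plane_def norm_mult mult_left_mono mult_ac)
  qed
qed (use meas_p meas_m meas_powr in measurable)

lemma cdpsi_deriv:
  assumes "z \<in> half_plane"
  shows "(cdpsi has_field_derivative cddpsi z) (at z)"
proof -
  let ?u = "\<lambda>t z. complex_of_real (p t) + z * of_real (m t)"
  have "((\<lambda>z. \<integral>t. of_real (m t) * ?u t z powr complex_of_real (-3/2) \<partial>M) has_field_derivative
          (\<integral>t. of_real (m t) * (of_real (-3/2) * of_real (m t) * ?u t z powr complex_of_real (-3/2 - 1)) \<partial>M)) (at z)"
  proof (rule has_field_derivative_integral_parameter[OF half_plane assms])
    show "integrable M (\<lambda>t. 3/2 * 2 powr (5/2) * (m t * p t powr (-3/2)))"
      using integrable_weight by simp
    fix t x assume t: "t \<in> space M" and x: "x \<in> half_plane"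
    have "norm (of_real (m t) * (of_real (-3/2) * of_real (m t) * ?u t x powr complex_of_real (-3/2 - 1)))
      = 3/2 * (m t)\<^sup>2 * norm (?u t x powr complex_of_real (-(5/2)))"
      using m_pos[OF t] by (simp add: norm_mult power2_eq_square)
    also have "\<dots> \<le> 3/2 * (m t)\<^sup>2 * (2 powr (5/2) * p t powr (-(5/2)))"
      using norm_powr_le[OF t, of x "5/2"] x
      by (intro mult_left_mono) (auto simp: half_plane_def)
    also have "\<dots> = 3/2 * 2 powr (5/2) * ((m t)\<^sup>2 * p t powr (-5/2))"
      by simp
    also have "\<dots> \<le> 3/2 * 2 powr (5/2) * (m t * p t powr (-3/2))"
      using weight_powr[OF t] by (intro mult_left_mono) auto
    finally show "norm (of_real (m t) * (of_real (-3/2) * of_real (m t) * ?u t x powr complex_of_real (-3/2 - 1)))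
      \<le> 3/2 * 2 powr (5/2) * (m t * p t powr (-3/2))" .
    show "((\<lambda>z. of_real (m t) * ?u t z powr complex_of_real (-3/2)) has_field_derivative
      of_real (m t) * (of_real (-3/2) * of_real (m t) * ?u t x powr complex_of_real (-3/2 - 1))) (at x)"
      using x by (intro DERIV_cmult powr_deriv t) (auto simp: half_plane_def)
  qed (use integrable_cdpsi meas_p meas_m meas_powr in measurable)
  also have "(\<integral>t. of_real (m t) * (of_real (-3/2) * of_real (m t) * ?u t z powr complex_of_real (-3/2 - 1)) \<partial>M)
     = (\<integral>t. -3/2 * (of_real ((m t)\<^sup>2) * ?u t z powr complex_of_real (-5/2)) \<partial>M)"
    by (simp add: power2_eq_square mult_ac)
  also have "\<dots> = cddpsi z"
    unfolding cddpsi_def by (rule integral_mult_right_zero)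
  finally show ?thesis
    unfolding cdpsi_def .
qed

text \<open>
  The mean value inequality between \<open>0\<close> and \<open>z\<close> gains the factor \<open>m / p\<close> that makes the difference
  of the two powers integrable.
\<close>

lemma integrable_cpsi:
  assumes "z \<in> half_plane"
  shows "integrable M (\<lambda>t. complex_of_real (p t powr (-1/2)) -
                    (of_real (p t) + z * of_real (m t)) powr of_real (-1/2))"
proof (rule Bochner_Integration.integrable_bound)
  show "integrable M (\<lambda>t. norm z * 2 powr (1/2) * (m t * p t powr (-3/2)))"
    using integrable_weight by (rule integrable_mult_right)
  show "AE t in M. norm (complex_of_real (p t powr (-1/2)) -
                    (of_real (p t) + z * of_real (m t)) powr of_real (-1/2))
          \<le> norm (norm z * 2 powr (1/2) * (m t * p t powr (-3/2)))"
  proof (rule AE_I2)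
    fix t assume t: "t \<in> space M"
    let ?f = "\<lambda>z. (of_real (p t) + z * of_real (m t)) powr complex_of_real (-1/2)"
    have *: "norm (?f 0 - ?f z) \<le> (2 powr (1/2) * (m t * p t powr (-3/2))) * norm (0 - z)"
    proof (rule field_differentiable_bound[OF half_plane(2), where f' = "\<lambda>z. of_real (-1/2) * of_real (m t) *
         (of_real (p t) + z * of_real (m t)) powr complex_of_real (-1/2 - 1)"])
      fix x assume x: "x \<in> half_plane"
      show "(?f has_field_derivative of_real (-1/2) * of_real (m t) *
         (of_real (p t) + x * of_real (m t)) powr complex_of_real (-1/2 - 1)) (at x within half_plane)"
        using x by (intro has_field_derivative_at_within[OF powr_deriv[OF t]]) (auto simp: half_plane_def)
      have "norm (of_real (-1/2) * of_real (m t) *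
         (of_real (p t) + x * of_real (m t)) powr complex_of_real (-1/2 - 1))
         = 1/2 * m t * norm ((of_real (p t) + x * of_real (m t)) powr complex_of_real (- (3/2)))"
        using m_pos[OF t] by (simp add: norm_mult)
      also have "\<dots> \<le> 1/2 * m t * (2 powr (3/2) * p t powr (-(3/2)))"
        using norm_powr_le[OF t, of x "3/2"] x m_pos[OF t]
        by (intro mult_left_mono) (auto simp: half_plane_def)
      also have "2 powr (3/2) = 2 * 2 powr (1/2::real)"
        using powr_add[of "2::real" 1 "1/2"] by simp
      finally show "norm (of_real (-1/2) * of_real (m t) *
         (of_real (p t) + x * of_real (m t)) powr complex_of_real (-1/2 - 1))
         \<le> 2 powr (1/2) * (m t * p t powr (-3/2))"
        by (simp add: mult_ac)
    qed (use assms in \<open>auto simp: half_plane_def\<close>)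
    have "complex_of_real (p t powr (-1/2)) = ?f 0"
      using p_pos[OF t] powr_of_real[of "p t" "-1/2"] by simp
    with * m_pos[OF t] show "norm (complex_of_real (p t powr (-1/2)) - ?f z)
       \<le> norm (norm z * 2 powr (1/2) * (m t * p t powr (-3/2)))"
      by (simp add: mult_ac)
  qed
qed (use meas_p meas_m meas_powr in measurable)

lemma cpsi_deriv:
  assumes "z \<in> half_plane"
  shows "(cpsi has_field_derivative cdpsi z) (at z)"
proof -
  let ?u = "\<lambda>t z. complex_of_real (p t) + z * of_real (m t)"
  have "((\<lambda>z. \<integral>t. of_real (p t powr (-1/2)) - ?u t z powr complex_of_real (-1/2) \<partial>M) has_field_derivative
          (\<integral>t. 0 - (of_real (-1/2) * of_real (m t) * ?u t z powr complex_of_real (-1/2 - 1)) \<partial>M)) (at z)"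
  proof (rule has_field_derivative_integral_parameter[OF half_plane assms])
    show "integrable M (\<lambda>t. 1/2 * 2 powr (3/2) * (m t * p t powr (-3/2)))"
      using integrable_weight by simp
    fix t x assume t: "t \<in> space M" and x: "x \<in> half_plane"
    have "norm (0 - (of_real (-1/2) * of_real (m t) * ?u t x powr complex_of_real (-1/2 - 1)))
      = 1/2 * m t * norm (?u t x powr complex_of_real (-(3/2)))"
      using m_pos[OF t] by (simp add: norm_mult)
    also have "\<dots> \<le> 1/2 * m t * (2 powr (3/2) * p t powr (-(3/2)))"
      using norm_powr_le[OF t, of x "3/2"] x m_pos[OF t]
      by (intro mult_left_mono) (auto simp: half_plane_def)
    finally show "norm (0 - (of_real (-1/2) * of_real (m t) * ?u t x powr complex_of_real (-1/2 - 1)))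
      \<le> 1/2 * 2 powr (3/2) * (m t * p t powr (-3/2))"
      by (simp add: mult_ac)
    show "((\<lambda>z. of_real (p t powr (-1/2)) - ?u t z powr complex_of_real (-1/2)) has_field_derivative
      0 - (of_real (-1/2) * of_real (m t) * ?u t x powr complex_of_real (-1/2 - 1))) (at x)"
      using x by (intro DERIV_diff DERIV_const powr_deriv t) (auto simp: half_plane_def)
  qed (use integrable_cpsi meas_p meas_m meas_powr in measurable)
  also have "(\<integral>t. 0 - (of_real (-1/2) * of_real (m t) * ?u t z powr complex_of_real (-1/2 - 1)) \<partial>M)
     = (\<integral>t. 1/2 * (of_real (m t) * ?u t z powr complex_of_real (-3/2)) \<partial>M)"
    by (simp add: mult_ac)
  also have "\<dots> = 1/2 * cdpsi z"
    unfolding cdpsi_def by (rule integral_mult_right_zero)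
  finally show ?thesis
    unfolding cpsi_def using DERIV_cmult[where c = 2] by fastforce
qed

lemma of_real_powr:
  assumes "t \<in> space M" "w > -1"
  shows "(of_real (p t) + of_real w * of_real (m t)) powr complex_of_real a
           = of_real ((p t + w * m t) powr a)"
proof -
  have "p t + w * m t \<ge> 0"
    using Re_ge[OF assms(1), of "of_real w"] assms p_pos[of t] by simp
  then show ?thesis
    using powr_of_real[of "p t + w * m t" a] by simp
qed

lemma cpsi_of_real:
  assumes "w > -1"
  shows "cpsi (of_real w) = of_real (psi w)"
proof -
  have "cpsi (of_real w) = 2 * (\<integral>t. complex_of_real (p t powr (-1/2) - (p t + w * m t) powr (-1/2)) \<partial>M)"
    unfolding cpsi_def
    by (intro arg_cong[where f = "(*) 2"] Bochner_Integration.integral_cong refl)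
      (use of_real_powr[OF _ assms, of _ "-1/2"] in simp)
  then show ?thesis
    unfolding psi_def by (simp only: integral_complex_of_real) simp
qed

lemma cdpsi_of_real:
  assumes "w > -1"
  shows "cdpsi (of_real w) = of_real (dpsi w)"
proof -
  have "cdpsi (of_real w) = (\<integral>t. complex_of_real (m t * (p t + w * m t) powr (-3/2)) \<partial>M)"
    unfolding cdpsi_def
    by (intro Bochner_Integration.integral_cong refl)
      (use of_real_powr[OF _ assms, of _ "-3/2"] in simp)
  then show ?thesis
    unfolding dpsi_def by (simp only: integral_complex_of_real)
qed

lemma psi_deriv:
  assumes "w > -1"
  shows "(psi has_real_derivative dpsi w) (at w)"
proof -
  have "((\<lambda>w. cpsi (of_real w)) has_vector_derivative cdpsi (of_real w)) (at w)"
    using cpsi_deriv[of "of_real w"] assms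
    by (intro has_vector_derivative_real_field) (auto simp: half_plane_def)
  then have "((\<lambda>w. Re (cpsi (of_real w))) has_vector_derivative Re (cdpsi (of_real w))) (at w)"
    by (rule bounded_linear.has_vector_derivative[OF bounded_linear_Re])
  then have "((\<lambda>w. Re (cpsi (of_real w))) has_real_derivative dpsi w) (at w)"
    using assms by (simp add: cdpsi_of_real has_real_derivative_iff_has_vector_derivative)
  moreover have "\<forall>\<^sub>F v in nhds w. Re (cpsi (of_real v)) = psi v"
    using eventually_nhds_in_open[of "{-1<..}" w] assms
    by (auto elim!: eventually_mono simp: cpsi_of_real)
  ultimately show ?thesis
    by (subst (asm) DERIV_cong_ev[OF refl _ refl])
qed

lemma psi_0: "psi 0 = 0"
  by (simp add: psi_def)

lemma integrable_dpsi:
  assumes "w > -1"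
  shows "integrable M (\<lambda>t. m t * (p t + w * m t) powr (-3/2))"
proof -
  have "integrable M (\<lambda>t. complex_of_real (m t * (p t + w * m t) powr (-3/2)))"
    using integrable_cdpsi[of "of_real w"] assms of_real_powr[OF _ assms, of _ "-3/2"]
    by (subst Bochner_Integration.integrable_cong[OF refl]) (auto simp: half_plane_def)
  then show ?thesis
    by (simp only: complex_of_real_integrable_eq)
qed

lemma dpsi_pos:
  assumes "w > -1"
  shows "dpsi w > 0"
proof -
  have pos: "m t * (p t + w * m t) powr (-3/2) > 0" if "t \<in> space M" for t
    using Re_ge[OF that, of "of_real w"] assms p_pos[OF that] m_pos[OF that] by simp
  have "dpsi w \<noteq> 0"
  proof
    assume "dpsi w = 0"
    then have "AE t in M. m t * (p t + w * m t) powr (-3/2) = 0"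
      unfolding dpsi_def using pos
      by (subst (asm) integral_nonneg_eq_0_iff_AE[OF integrable_dpsi[OF assms]])
         (auto intro!: AE_I2 less_imp_le)
    then have "AE t in M. False"
      by (rule AE_mp) (use pos in \<open>force intro!: AE_I2\<close>)
    then show False
      using nontrivial emeasure_eq_0_AE[of "\<lambda>_. True" M] by simp
  qed
  moreover have "dpsi w \<ge> 0"
    unfolding dpsi_def using pos by (intro Bochner_Integration.integral_nonneg) (auto intro: less_imp_le)
  ultimately show ?thesis by simp
qed

lemma cpsi_holomorphic: "cpsi holomorphic_on half_plane"
  using cpsi_deriv half_plane(1) by (auto simp: holomorphic_on_open)

lemma cdpsi_holomorphic: "cdpsi holomorphic_on half_plane"
  using cdpsi_deriv half_plane(1) by (auto simp: holomorphic_on_open)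

lemma deriv_cpsi: "z \<in> half_plane \<Longrightarrow> deriv cpsi z = cdpsi z"
  using cpsi_deriv by (rule DERIV_imp_deriv)

lemma isCont_dpsi:
  assumes "w > -1"
  shows "isCont dpsi w"
proof -
  have "isCont cdpsi (of_real w)"
    using assms by (intro DERIV_isCont[OF cdpsi_deriv]) (auto simp: half_plane_def)
  then have "isCont (\<lambda>w. cdpsi (of_real w)) w"
    by (intro isCont_o2[where f = of_real and g = cdpsi]) auto
  then have cont: "isCont (\<lambda>w. Re (cdpsi (of_real w))) w"
    by (rule bounded_linear.isCont[OF bounded_linear_Re])
  have "\<forall>\<^sub>F v in nhds w. Re (cdpsi (of_real v)) = dpsi v"
    using eventually_nhds_in_open[of "{-1<..}" w] assms
    by (auto elim!: eventually_mono simp: cdpsi_of_real)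
  from iffD1[OF isCont_cong[OF this] cont] show ?thesis .
qed

lemma psi_strict_mono:
  assumes "-1 < v" "v < w"
  shows "psi v < psi w"
proof (rule DERIV_pos_imp_increasing[OF assms(2)])
  show "\<exists>y. DERIV psi x :> y \<and> 0 < y" if "v \<le> x" "x \<le> w" for x
    using psi_deriv[of x] dpsi_pos[of x] that assms by auto
qed

lemma psi_less_iff:
  assumes "-1 < v" "-1 < w"
  shows "psi v < psi w \<longleftrightarrow> v < w"
  using psi_strict_mono[of v w] psi_strict_mono[of w v] assms
  by (cases v w rule: linorder_cases) auto

lemma psi_eq_iff:
  assumes "-1 < v" "-1 < w"
  shows "psi v = psi w \<longleftrightarrow> v = w"
  using psi_less_iff[of v w] psi_less_iff[of w v] assms
  by (cases v w rule: linorder_cases) auto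

lemma psi_pos: "w > 0 \<Longrightarrow> psi w > 0"
  using psi_strict_mono[of 0 w] psi_0 by simp

lemma isCont_psi: "w > -1 \<Longrightarrow> isCont psi w"
  using psi_deriv DERIV_isCont by blast

lemma psi_IVT:
  assumes "0 \<le> a" "a < b" "psi a < y" "y < psi b"
  obtains w where "a < w" "w < b" "psi w = y"
proof -
  have "\<exists>w\<ge>a. w \<le> b \<and> psi w = y"
    using assms by (intro IVT) (auto intro!: isCont_psi)
  then obtain w where "a \<le> w" "w \<le> b" "psi w = y" by blast
  with assms show ?thesis
    by (intro that[of w]) (auto simp: less_le)
qed

end

section \<open>Integrals over the half line\<close>

abbreviation half_line :: "real measure" where
  "half_line \<equiv> restrict_space lborel {0<..}"

lemma space_half_line [simp]: "space half_line = {0<..}"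
  by (simp add: space_restrict_space)

lemma integrable_half_line_iff: "integrable half_line f \<longleftrightarrow> set_integrable lborel {0<..} f"
  for f :: "real \<Rightarrow> real"
  unfolding set_integrable_def by (rule integrable_restrict_space) simp

lemma integral_half_line_eq: "integral\<^sup>L half_line f = (LINT t:{0<..}|lborel. f t)"
  for f :: "real \<Rightarrow> real"
  unfolding set_lebesgue_integral_def by (rule integral_restrict_space) simp

lemma measurable_half_line:
  "f \<in> borel_measurable borel \<Longrightarrow> f \<in> borel_measurable half_line"
  by (rule measurable_restrict_space1) simp

lemma half_line_FTC_nonneg:
  fixes f F :: "real \<Rightarrow> real"
  assumes "\<And>t. t > 0 \<Longrightarrow> (F has_real_derivative f t) (at t)"
    and "\<And>t. t > 0 \<Longrightarrow> isCont f t" "\<And>t. t > 0 \<Longrightarrow> f t \<ge> 0"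
    and "(F \<longlongrightarrow> A) (at_right 0)" "(F \<longlongrightarrow> B) at_top"
  shows "integrable half_line f" "integral\<^sup>L half_line f = B - A"
proof -
  have e: "einterval 0 \<infinity> = {0<..}"
    by (auto simp: einterval_def)
  have lim: "((F \<circ> real_of_ereal) \<longlongrightarrow> A) (at_right 0)" "((F \<circ> real_of_ereal) \<longlongrightarrow> B) (at_left \<infinity>)"
    using assms(4,5) by (simp_all only: zero_ereal_def ereal_tendsto_simps1)
  have "set_integrable lborel (einterval 0 \<infinity>) f" "(LBINT x=0..\<infinity>. f x) = B - A"
    by (rule interval_integral_FTC_nonneg[OF _ _ _ _ lim]; use assms(1-3) in simp)+
  then show "integrable half_line f" "integral\<^sup>L half_line f = B - A"
    by (simp_all only: e interval_lebesgue_integral_0_infty integrable_half_line_iff integral_half_line_eq)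
qed

lemma half_line_FTC:
  fixes f F :: "real \<Rightarrow> real"
  assumes "\<And>t. t > 0 \<Longrightarrow> (F has_real_derivative f t) (at t)"
    and "\<And>t. t > 0 \<Longrightarrow> isCont f t" "integrable half_line f"
    and "(F \<longlongrightarrow> A) (at_right 0)" "(F \<longlongrightarrow> B) at_top"
  shows "integral\<^sup>L half_line f = B - A"
proof -
  have e: "einterval 0 \<infinity> = {0<..}"
    by (auto simp: einterval_def)
  have lim: "((F \<circ> real_of_ereal) \<longlongrightarrow> A) (at_right 0)" "((F \<circ> real_of_ereal) \<longlongrightarrow> B) (at_left \<infinity>)"
    using assms(4,5) by (simp_all only: zero_ereal_def ereal_tendsto_simps1)
  have "(LBINT x=0..\<infinity>. f x) = B - A"
    by (rule interval_integral_FTC_integrable[OF _ _ _ _ lim])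
       (use assms(1-3) in \<open>simp_all add: e integrable_half_line_iff
          flip: has_real_derivative_iff_has_vector_derivative\<close>)
  then show ?thesis
    by (simp only: interval_lebesgue_integral_0_infty integral_half_line_eq)
qed

lemma half_line_scale:
  fixes f :: "real \<Rightarrow> real"
  assumes "c > 0"
  shows "integral\<^sup>L half_line (\<lambda>t. f (c * t)) = integral\<^sup>L half_line f / c"
    and "integrable half_line (\<lambda>t. f (c * t)) \<longleftrightarrow> integrable half_line f"
proof -
  have *: "indicator {0<..} (c * t) = (indicator {0<..} t :: real)" for t
    using assms by (auto simp: indicator_def zero_less_mult_iff)
  show "integral\<^sup>L half_line (\<lambda>t. f (c * t)) = integral\<^sup>L half_line f / c"
    using lborel_integral_real_affine[of c "\<lambda>t. indicator {0<..} t *\<^sub>R f t" 0] assms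
    by (simp add: integral_half_line_eq set_lebesgue_integral_def *)
  show "integrable half_line (\<lambda>t. f (c * t)) \<longleftrightarrow> integrable half_line f"
    using lborel_integrable_real_affine_iff[of c "\<lambda>t. indicator {0<..} t *\<^sub>R f t" 0] assms
    by (simp add: integrable_half_line_iff set_integrable_def *)
qed

text \<open>
  This majorant has the elementary primitive \<open>2 arctan (sqrt t)\<close>. It stands for
  \<open>min (t^(-1/2)) (t^(-3/2))\<close>, the shape of the pointwise bounds to which it is applied.
\<close>

lemma integrable_majorant: "integrable half_line (\<lambda>t. t powr (-1/2) / (1 + t))"
proof (rule half_line_FTC_nonneg(1))
  show "((\<lambda>t. 2 * arctan (t powr (1/2))) \<longlongrightarrow> 0) (at_right 0)"
    by real_asymp
  show "((\<lambda>t. 2 * arctan (t powr (1/2))) \<longlongrightarrow> pi) at_top"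
    by real_asymp
  fix t :: real assume t: "t > 0"
  have "(t powr (1/2))\<^sup>2 = t"
    using t by (simp add: powr_half_sqrt)
  then show "((\<lambda>t. 2 * arctan (t powr (1/2))) has_real_derivative t powr (-1/2) / (1 + t)) (at t)"
    using t by (auto intro!: derivative_eq_intros simp: field_simps)
  show "isCont (\<lambda>t. t powr (-1/2) / (1 + t)) t"
    using t by (auto intro!: continuous_intros)
qed auto

lemma integrable_half_line_bound:
  fixes f :: "real \<Rightarrow> real"
  assumes "integrable half_line g" "f \<in> borel_measurable borel"
    "\<And>t. t > 0 \<Longrightarrow> \<bar>f t\<bar> \<le> g t"
  shows "integrable half_line f"
proof (rule Bochner_Integration.integrable_bound[OF assms(1)])
  show "AE t in half_line. norm (f t) \<le> norm (g t)"
    using assms(3) by (intro AE_I2) fastforce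
qed (rule measurable_half_line[OF assms(2)])

lemma one_minus_exp_le: "1 - exp (-x) \<le> x" for x :: real
  using exp_ge_add_one_self[of "-x"] by simp

lemma min_le_majorant:
  assumes "t > 0" "(x::real) \<le> t powr (-1/2)" "x \<le> t powr (-3/2)"
  shows "x \<le> 2 * (t powr (-1/2) / (1 + t))"
proof -
  \<comment> \<open>The two bounds on \<open>x\<close> give bounds on \<open>x\<close> and on \<open>t * x\<close>, which are added.\<close>
  have "t * x \<le> t powr 1 * t powr (-3/2)"
    using assms by (auto intro!: mult_mono)
  also have "\<dots> = t powr (-1/2)"
    by (subst powr_add[symmetric]) simp
  finally show ?thesis
    using assms by (simp add: field_simps)
qed

lemma integrable_frullani_half:
  assumes "c > (0::real)"
  shows "integrable half_line (\<lambda>t. (1 - exp (- c * t)) * t powr (-3/2))"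
proof -
  have "integrable half_line (\<lambda>t. (1 - exp (-t)) * t powr (-3/2))"
  proof (rule integrable_half_line_bound)
    show "integrable half_line (\<lambda>t. 2 * (t powr (-1/2) / (1 + t)))"
      using integrable_majorant by (rule integrable_mult_right)
    fix t :: real assume t: "t > 0"
    have "(1 - exp (-t)) * t powr (-3/2) \<le> t powr 1 * t powr (-3/2)"
      using t one_minus_exp_le[of t] by (intro mult_right_mono) auto
    also have "\<dots> = t powr (-1/2)"
      by (subst powr_add[symmetric]) simp
    finally have "(1 - exp (-t)) * t powr (-3/2) \<le> 2 * (t powr (-1/2) / (1 + t))"
      using t by (intro min_le_majorant) (auto intro!: mult_left_le_one_le)
    then show "\<bar>(1 - exp (-t)) * t powr (-3/2)\<bar> \<le> 2 * (t powr (-1/2) / (1 + t))"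
      using t by (simp add: abs_mult)
  qed measurable
  then have "integrable half_line (\<lambda>t. (1 - exp (- (c * t))) * (c * t) powr (-3/2))"
    using half_line_scale(2)[OF assms, of "\<lambda>t. (1 - exp (-t)) * t powr (-3/2)"] by simp
  then have "integrable half_line (\<lambda>t. c powr (3/2) * ((1 - exp (- (c * t))) * (c * t) powr (-3/2)))"
    by (rule integrable_mult_right)
  also have "?this \<longleftrightarrow> ?thesis"
    using assms
    by (intro Bochner_Integration.integrable_cong refl)
       (auto simp: powr_mult powr_minus field_simps)
  finally show ?thesis .
qed

lemma integral_Gamma_half:
  assumes "c > (0::real)"
  shows "integrable half_line (\<lambda>t. exp (- c * t) * t powr (-1/2))"
    and "integral\<^sup>L half_line (\<lambda>t. exp (- c * t) * t powr (-1/2)) = sqrt (pi / c)"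
proof -
  let ?f = "\<lambda>t::real. exp (-t) * t powr (-1/2)"
  let ?g = "\<lambda>t. indicator {0..} t * t powr (1/2 - 1) / exp t :: real"
  have "integral\<^sup>N lborel (\<lambda>t. ennreal (?g t)) = ennreal (Gamma (1/2))"
    using Gamma_conv_nn_integral_real[of "1/2"] by simp
  then have "integrable lborel ?g \<and> integral\<^sup>L lborel ?g = Gamma (1/2)"
    by (subst nn_integral_eq_integrable[symmetric]) (auto simp: Gamma_real_nonneg)
  moreover have "?g t = indicator {0<..} t *\<^sub>R ?f t" for t
    by (cases "t = 0") (auto simp: indicator_def exp_minus field_simps)
  ultimately have "integrable half_line ?f" "integral\<^sup>L half_line ?f = sqrt pi"
    by (simp_all add: integrable_half_line_iff integral_half_line_eq set_integrable_def
        set_lebesgue_integral_def Gamma_one_half_real)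
  then have *: "integrable half_line (\<lambda>t. exp (- (c * t)) * (c * t) powr (-1/2))"
      "integral\<^sup>L half_line (\<lambda>t. exp (- (c * t)) * (c * t) powr (-1/2)) = sqrt pi / c"
    using half_line_scale[OF assms, of ?f] by auto
  have eq: "exp (- c * t) * t powr (-1/2) = sqrt c * (exp (- (c * t)) * (c * t) powr (-1/2))"
    if "t \<in> space half_line" for t
    using that assms by (simp add: powr_mult powr_minus powr_half_sqrt field_simps)
  show "integrable half_line (\<lambda>t. exp (- c * t) * t powr (-1/2))"
    using * by (subst Bochner_Integration.integrable_cong[OF refl eq]) auto
  have "integral\<^sup>L half_line (\<lambda>t. exp (- c * t) * t powr (-1/2)) = sqrt c * (sqrt pi / c)"
    unfolding *(2)[symmetric]
    by (subst Bochner_Integration.integral_cong[OF refl eq]) (auto simp only: integral_mult_right_zero)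
  also have "\<dots> = sqrt (pi / c)"
    using assms by (simp add: real_sqrt_divide real_div_sqrt field_simps)
  finally show "integral\<^sup>L half_line (\<lambda>t. exp (- c * t) * t powr (-1/2)) = sqrt (pi / c)" .
qed

text \<open>
  The boundary terms of \<open>(1 - exp (- c t)) t^(-1/2)\<close> vanish at both ends, so integration by parts
  leads to the Gamma integral at \<open>1/2\<close>.
\<close>

lemma integral_frullani_half:
  assumes "c > (0::real)"
  shows "integral\<^sup>L half_line (\<lambda>t. (1 - exp (- c * t)) * t powr (-3/2)) = 2 * sqrt (pi * c)"
proof -
  let ?f = "\<lambda>t. (1 - exp (- c * t)) * t powr (-3/2)"
  let ?g = "\<lambda>t. 2 * c * (exp (- c * t) * t powr (-1/2))"
  have int: "integrable half_line ?f" "integrable half_line ?g"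
    using integrable_frullani_half[OF assms] integral_Gamma_half(1)[OF assms] by auto
  have "integral\<^sup>L half_line (\<lambda>t. ?f t - ?g t) = 0 - 0"
  proof (rule half_line_FTC)
    let ?F = "\<lambda>t. - 2 * ((1 - exp (- c * t)) * t powr (-1/2))"
    show "(?F \<longlongrightarrow> 0) (at_right 0)" "(?F \<longlongrightarrow> 0) at_top"
      using assms by real_asymp+
    show "(?F has_real_derivative ?f t - ?g t) (at t)" if "t > 0" for t
      using that by (auto intro!: derivative_eq_intros simp: field_simps)
    show "isCont (\<lambda>t. ?f t - ?g t) t" if "t > 0" for t
      using that by (auto intro!: continuous_intros)
  qed (use int in auto)
  then have "integral\<^sup>L half_line ?f = integral\<^sup>L half_line ?g"
    using int by simp
  also have "\<dots> = 2 * c * sqrt (pi / c)"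
    by (simp only: integral_mult_right_zero integral_Gamma_half(2)[OF assms])
  also have "\<dots> = 2 * sqrt (pi * c)"
    using assms by (simp add: real_sqrt_divide real_sqrt_mult real_div_sqrt field_simps)
  finally show ?thesis .
qed

text \<open>
  Integration by parts again, now using
  \<open>(1 - exp (-t)) exp (-t) = (1 - exp (-2 t)) - (1 - exp (-t))\<close> to return to the previous integral.
\<close>

lemma integral_frullani_squared:
  "integral\<^sup>L half_line (\<lambda>t. (1 - exp (-t))\<^sup>2 * t powr (-5/2)) = 8/3 * sqrt pi * (sqrt 2 - 1)"
proof -
  let ?h = "\<lambda>c t. (1 - exp (- c * t)) * t powr (-3/2) :: real"
  let ?f = "\<lambda>t. (1 - exp (-t))\<^sup>2 * t powr (-5/2) :: real"
  let ?g = "\<lambda>t. 4/3 * (?h 2 t - ?h 1 t)"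
  have int: "integrable half_line (?h 1)" "integrable half_line (?h 2)"
    using integrable_frullani_half[of 1] integrable_frullani_half[of 2] by auto
  have intf: "integrable half_line ?f"
  proof (rule integrable_half_line_bound[OF int(1)])
    fix t :: real assume t: "t > 0"
    have "(1 - exp (-t))\<^sup>2 * t powr (-5/2) \<le> ((1 - exp (-t)) * t) * t powr (-5/2)"
      unfolding power2_eq_square
      using t one_minus_exp_le[of t] by (intro mult_right_mono mult_left_mono) auto
    also have "\<dots> = (1 - exp (-t)) * (t * t powr (-5/2))"
      by (rule mult.assoc)
    also have "t * t powr (-5/2) = t powr (-3/2)"
      using t powr_add[of t 1 "-5/2"] by simp
    finally show "\<bar>?f t\<bar> \<le> ?h 1 t"
      using t by (simp add: mult.assoc)
  qed measurable
  have "integral\<^sup>L half_line (\<lambda>t. ?f t - ?g t) = 0 - 0"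
  proof (rule half_line_FTC)
    let ?F = "\<lambda>t::real. - 2/3 * ((1 - exp (-t))\<^sup>2 * t powr (-3/2))"
    show "(?F \<longlongrightarrow> 0) (at_right 0)" "(?F \<longlongrightarrow> 0) at_top"
      by real_asymp+
    show "(?F has_real_derivative ?f t - ?g t) (at t)" if "t > 0" for t
    proof -
      have e: "exp (- 2 * t) = exp (-t) * exp (-t)" by (simp flip: exp_add)
      show ?thesis
        using that unfolding e
        by (auto intro!: derivative_eq_intros simp: field_simps power2_eq_square)
    qed
    show "isCont (\<lambda>t. ?f t - ?g t) t" if "t > 0" for t
      using that by (auto intro!: continuous_intros)
  qed (use int intf in auto)
  then have "integral\<^sup>L half_line ?f = 4/3 * (integral\<^sup>L half_line (?h 2) - integral\<^sup>L half_line (?h 1))"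
    using int intf by simp
  then show ?thesis
    using integral_frullani_half[of 1] integral_frullani_half[of 2]
    by (simp add: real_sqrt_mult algebra_simps)
qed

section \<open>The deflection function in the grazing limit\<close>

lemma emeasure_half_line: "emeasure half_line (space half_line) \<noteq> 0"
proof -
  have "emeasure lborel {0<..<1::real} \<le> emeasure lborel {0::real<..}"
    by (intro emeasure_mono) auto
  also have "\<dots> = emeasure half_line {0<..}"
    by (subst emeasure_restrict_space) auto
  finally show ?thesis by auto
qed

text \<open>
  The weights of the grazing limit. At \<open>w = 0\<close> the derivatives of the resulting function are Gamma
  integrals, which is where the powers of \<open>pi\<close> in the small-angle expansion come from.
\<close>

interpretation grazing: deflection half_line "\<lambda>t. 2 * t" "\<lambda>t. 1 - exp (-t)"
proof
  have "integrable half_line (\<lambda>t. 2 powr (-3/2) * ((1 - exp (-t)) * t powr (-3/2)))"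
    using integrable_frullani_half[of 1] by (intro integrable_mult_right) simp
  then show "integrable half_line (\<lambda>t. (1 - exp (-t)) * (2 * t) powr (-3/2))"
    by (subst Bochner_Integration.integrable_cong[OF refl]) (auto simp: powr_mult mult_ac)
  show "0 < 1 - exp (-t)" "2 * (1 - exp (-t)) \<le> 2 * t" if "t \<in> space half_line" for t
    using that one_minus_exp_le[of t] by auto
  show "(\<lambda>t. 2 * t) \<in> borel_measurable half_line" "(\<lambda>t. 1 - exp (-t)) \<in> borel_measurable half_line"
    by (rule measurable_half_line; measurable)+
qed (rule emeasure_half_line)

lemma grazing_dpsi_0: "grazing.dpsi 0 = sqrt (pi / 2)"
proof -
  have "grazing.dpsi 0 = (\<integral>t. 2 powr (-3/2) * ((1 - exp (- 1 * t)) * t powr (-3/2)) \<partial>half_line)"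
    unfolding grazing.dpsi_def
    by (intro Bochner_Integration.integral_cong refl) (auto simp: powr_mult mult_ac)
  also have "\<dots> = 2 powr (-3/2) * (2 * sqrt (pi * 1))"
    by (simp only: integral_mult_right_zero integral_frullani_half)
  also have "2 powr (-3/2) = 1 / (2 * sqrt (2::real))"
    using powr_add[of 2 "-1" "-1/2::real"] by (simp add: powr_minus powr_half_sqrt field_simps)
  finally show ?thesis by (simp add: real_sqrt_divide)
qed

lemma grazing_cddpsi_0: "grazing.cddpsi 0 = complex_of_real (- sqrt pi * (1 - 1 / sqrt 2))"
proof -
  have "(\<integral>t. of_real ((1 - exp (-t))\<^sup>2) * (complex_of_real (2 * t) + 0 * of_real (1 - exp (-t))) powr of_real (-5/2) \<partial>half_line)
      = (\<integral>t. complex_of_real (2 powr (-5/2) * ((1 - exp (-t))\<^sup>2 * t powr (-5/2))) \<partial>half_line)"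
  proof (intro Bochner_Integration.integral_cong refl)
    fix t :: real assume "t \<in> space half_line"
    then have "complex_of_real (2 * t) powr of_real (-5/2) = of_real (2 powr (-5/2) * t powr (-5/2))"
      by (subst powr_of_real) (auto simp: powr_mult)
    then show "of_real ((1 - exp (-t))\<^sup>2) * (complex_of_real (2 * t) + 0 * of_real (1 - exp (-t))) powr of_real (-5/2)
       = complex_of_real (2 powr (-5/2) * ((1 - exp (-t))\<^sup>2 * t powr (-5/2)))"
      by (simp only: of_real_mult mult_zero_left add_0_right mult_ac)
  qed
  also have "\<dots> = complex_of_real (2 powr (-5/2) * (8/3 * sqrt pi * (sqrt 2 - 1)))"
    by (simp only: integral_complex_of_real integral_mult_right_zero integral_frullani_squared)
  also have "2 powr (-5/2) = 1 / (4 * sqrt (2::real))"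
    using powr_add[of 2 "-2" "-1/2::real"] by (simp add: powr_minus powr_half_sqrt field_simps)
  finally have "grazing.cddpsi 0 = -3/2 * complex_of_real (1 / (4 * sqrt 2) * (8/3 * sqrt pi * (sqrt 2 - 1)))"
    unfolding grazing.cddpsi_def by simp
  also have "\<dots> = complex_of_real (-3/2 * (1 / (4 * sqrt 2) * (8/3 * sqrt pi * (sqrt 2 - 1))))"
    by simp
  also have "-3/2 * (1 / (4 * sqrt 2) * (8/3 * sqrt pi * (sqrt 2 - 1))) = - sqrt pi * (1 - 1 / sqrt 2)"
    by (simp add: field_simps)
  finally show ?thesis .
qed

section \<open>Deflection functions at finite exponents and their convergence\<close>

text \<open>
  The weights at the exponent \<open>s = n + 1\<close>. They arise from substituting \<open>y = x_zero * exp (- t / n)\<close>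
  in the defining integral of the deflection angle.
\<close>

definition fin_p :: "real \<Rightarrow> real \<Rightarrow> real" where
  "fin_p n t = n * (exp (2 * t / n) - 1)"

definition fin_m :: "real \<Rightarrow> real \<Rightarrow> real" where
  "fin_m n t = exp (2 * t / n) * (1 - exp (-t))"

lemma measurable_fin [measurable]:
  "fin_p n \<in> borel_measurable borel" "fin_m n \<in> borel_measurable borel"
  unfolding fin_p_def fin_m_def by measurable

text \<open>
  The weight at exponent \<open>n\<close> is dominated by the limiting one uniformly in \<open>n\<close>. Both
  \<open>fin_m\<close> and \<open>fin_p\<close> grow like \<open>exp (2 t / n)\<close>, so the quotient decays only because
  \<open>fin_p\<close> carries the larger power \<open>3/2\<close>; the inequality \<open>u \<le> exp u - exp (-2 u)\<close> extracts exactly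
  the factor \<open>exp (4 t / (3 n))\<close> from \<open>fin_p\<close> that is needed to cancel the growth.
\<close>

lemma fin_weight_le:
  assumes "n > 0" "t > 0"
  shows "fin_m n t * fin_p n t powr (-3/2) \<le> 3 powr (3/2) * ((1 - exp (-t)) * (2 * t) powr (-3/2))"
proof -
  define u where "u = 2 * t / (3 * n)"
  have "u > 0" using assms by (simp add: u_def)
  then have "exp (-2 * u) \<le> 1" by simp
  with exp_ge_add_one_self[of u] have u: "u \<le> exp u - exp (-2 * u)" by linarith
  have "exp (4 * t / (3 * n)) * (2 * t / 3) = exp (2 * u) * (n * u)"
    using assms by (simp add: u_def field_simps)
  also have "\<dots> \<le> exp (2 * u) * (n * (exp u - exp (-2 * u)))"
    using assms u by (intro mult_left_mono) auto
  also have "\<dots> = n * (exp (3 * u) - 1)"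
    by (simp add: algebra_simps flip: exp_add)
  also have "\<dots> = fin_p n t"
    using assms by (simp add: fin_p_def u_def field_simps)
  finally have "fin_p n t powr (-3/2) \<le> (exp (4 * t / (3 * n)) * (2 * t / 3)) powr (-3/2)"
    using assms by (intro powr_mono2') auto
  also have "\<dots> = exp (- (2 * t / n)) * (3 powr (3/2) * (2 * t) powr (-3/2))"
    using assms by (simp add: powr_mult powr_divide exp_powr_real powr_minus exp_minus field_simps)
  finally have "fin_m n t * fin_p n t powr (-3/2)
     \<le> fin_m n t * (exp (- (2 * t / n)) * (3 powr (3/2) * (2 * t) powr (-3/2)))"
    using assms by (intro mult_left_mono) (auto simp: fin_m_def)
  also have "\<dots> = (exp (2 * t / n) * exp (- (2 * t / n))) * (3 powr (3/2) * ((1 - exp (-t)) * (2 * t) powr (-3/2)))"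
    by (simp only: fin_m_def mult_ac)
  finally show ?thesis by (simp flip: exp_add)
qed

text \<open>
  Convexity of \<open>exp\<close> on the segment from \<open>-t\<close> to \<open>0\<close>, at the point \<open>- 2 t / n\<close>.
\<close>

lemma fin_m_le_fin_p:
  assumes "n \<ge> 2" "t > 0"
  shows "2 * fin_m n t \<le> fin_p n t"
proof -
  have "exp ((1 - 2/n) * 0 + (2/n) * (-t)) \<le> (1 - 2/n) * exp 0 + (2/n) * exp (-t)"
    using assms convex_onD[OF exp_convex, of "2/n" 0 "-t"] by simp
  then have "2/n * (1 - exp (-t)) \<le> 1 - exp (- (2 * t / n))"
    by (simp add: algebra_simps diff_divide_distrib)
  then have "2 * (1 - exp (-t)) \<le> n * (1 - exp (- (2 * t / n)))"
    using assms by (simp add: field_simps)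
  then have "exp (2 * t / n) * (2 * (1 - exp (-t))) \<le> exp (2 * t / n) * (n * (1 - exp (- (2 * t / n))))"
    by (intro mult_left_mono) auto
  also have "\<dots> = n * (exp (2 * t / n) - exp (2 * t / n) * exp (- (2 * t / n)))"
    by (simp add: algebra_simps)
  also have "exp (2 * t / n) * exp (- (2 * t / n)) = 1"
    by (simp flip: exp_add)
  finally show ?thesis
    by (simp add: fin_p_def fin_m_def algebra_simps)
qed

lemma deflection_fin:
  assumes "n \<ge> 2"
  shows "deflection half_line (fin_p n) (fin_m n)"
proof
  show "fin_p n \<in> borel_measurable half_line" "fin_m n \<in> borel_measurable half_line"
    by (rule measurable_half_line; measurable)+
  show pos: "0 < fin_m n t" if "t \<in> space half_line" for t
    using that by (simp add: fin_m_def)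
  show "2 * fin_m n t \<le> fin_p n t" if "t \<in> space half_line" for t
    using that assms by (intro fin_m_le_fin_p) auto
  show "integrable half_line (\<lambda>t. fin_m n t * fin_p n t powr (-3/2))"
  proof (rule integrable_half_line_bound[OF integrable_mult_right[OF grazing.integrable_weight]])
    show "\<bar>fin_m n t * fin_p n t powr (-3/2)\<bar> \<le> 3 powr (3/2) * ((1 - exp (-t)) * (2 * t) powr (-3/2))" if "t > 0" for t
      using fin_weight_le[of n t] pos[of t] that assms by (simp add: abs_mult)
  qed measurable
qed (rule emeasure_half_line)

abbreviation fin_psi :: "real \<Rightarrow> real \<Rightarrow> real" where
  "fin_psi n \<equiv> deflection.psi half_line (fin_p n) (fin_m n)"

abbreviation fin_dpsi :: "real \<Rightarrow> real \<Rightarrow> real" where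
  "fin_dpsi n \<equiv> deflection.dpsi half_line (fin_p n) (fin_m n)"

lemma powr_minus_half_diff_le:
  assumes "0 < a" "a \<le> (b::real)"
  shows "\<bar>a powr (-1/2) - b powr (-1/2)\<bar> \<le> (b - a) * a powr (-3/2)"
proof -
  define r s where "r = sqrt a" and "s = sqrt b"
  have rs: "0 < r" "r \<le> s" "a = r\<^sup>2" "b = s\<^sup>2"
    using assms by (auto simp: r_def s_def)
  have 1: "a powr (-1/2) = 1 / r" "b powr (-1/2) = 1 / s"
    using assms by (auto simp: r_def s_def powr_minus powr_half_sqrt field_simps)
  have "a powr (-3/2) = a powr (-1) * a powr (-1/2)"
    by (subst powr_add[symmetric]) simp
  then have 2: "a powr (-3/2) = 1 / (r\<^sup>2 * r)"
    using assms unfolding 1 by (simp add: rs powr_minus field_simps)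
  have "1 / r - 1 / s = (s - r) * (1 / (r * s))"
    using rs by (simp add: field_simps)
  also have "\<dots> \<le> (s - r) * ((s + r) / (r\<^sup>2 * r))"
  proof (rule mult_left_mono)
    have "r * r \<le> s * (s + r)"
      using rs by (intro mult_mono) auto
    then show "1 / (r * s) \<le> (s + r) / (r\<^sup>2 * r)"
      using rs by (simp add: field_simps power2_eq_square)
  qed (use rs in auto)
  also have "\<dots> = (b - a) * a powr (-3/2)"
    unfolding 2 by (simp add: rs power2_eq_square field_simps)
  finally have "1 / r - 1 / s \<le> (b - a) * a powr (-3/2)" .
  moreover have "1 / s \<le> 1 / r" using rs by (simp add: field_simps)
  ultimately show ?thesis unfolding 1 by simp
qed

text \<open>
  Dominated convergence with a majorant that depends on neither the exponent nor, for bounded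
  parameters, on the parameter. Both vary together here: this joint convergence is what turns pointwise limits
  into locally uniform ones.
\<close>

lemma fin_psi_tendsto:
  fixes N W :: "nat \<Rightarrow> real"
  assumes N: "filterlim N at_top sequentially" "\<And>k. N k \<ge> 2"
    and W: "W \<longlonglongrightarrow> w" "\<And>k. W k \<ge> 0"
  shows "(\<lambda>k. fin_psi (N k) (W k)) \<longlonglongrightarrow> grazing.psi w"
    and "(\<lambda>k. fin_dpsi (N k) (W k)) \<longlonglongrightarrow> grazing.dpsi w"
proof -
  have w: "w \<ge> 0" using W LIMSEQ_le_const by blast
  obtain B where B: "\<And>k. W k \<le> B"
    using convergent_imp_Bseq[OF convergentI[OF W(1)]] by (auto simp: Bseq_def dest: abs_le_D1)
  have p: "(\<lambda>k. fin_p (N k) t) \<longlonglongrightarrow> 2 * t" for t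
    unfolding fin_p_def by (rule filterlim_compose[OF _ N(1)]) real_asymp
  have "((\<lambda>n. exp (2 * t / n) * (1 - exp (-t))) \<longlongrightarrow> exp 0 * (1 - exp (-t))) at_top" for t :: real
    by (intro tendsto_intros) real_asymp
  from filterlim_compose[OF this N(1)] have m: "(\<lambda>k. fin_m (N k) t) \<longlonglongrightarrow> 1 - exp (-t)" for t
    by (simp add: fin_m_def)
  interpret fin: deflection half_line "fin_p (N k)" "fin_m (N k)" for k
    using N(2) by (rule deflection_fin)
  have weight: "fin_m (N k) t * fin_p (N k) t powr (-3/2) \<le> 3 powr (3/2) * ((1 - exp (-t)) * (2 * t) powr (-3/2))"
    if "t > 0" for t k
    using fin_weight_le[of "N k" t] that N(2)[of k] by simp
  have limpos: "2 * t + w * (1 - exp (-t)) \<noteq> 0" if "t > 0" for t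
  proof -
    have "w * (1 - exp (-t)) \<ge> 0" using w that by (intro mult_nonneg_nonneg) auto
    with that show ?thesis by simp
  qed
  have "(\<lambda>k. \<integral>t. fin_p (N k) t powr (-1/2) - (fin_p (N k) t + W k * fin_m (N k) t) powr (-1/2) \<partial>half_line)
     \<longlonglongrightarrow> (\<integral>t. (2 * t) powr (-1/2) - (2 * t + w * (1 - exp (-t))) powr (-1/2) \<partial>half_line)"
  proof (rule integral_dominated_convergence[where w = "\<lambda>t. B * (3 powr (3/2) * ((1 - exp (-t)) * (2 * t) powr (-3/2)))"])
    show "integrable half_line (\<lambda>t. B * (3 powr (3/2) * ((1 - exp (-t)) * (2 * t) powr (-3/2))))"
      using grazing.integrable_weight by (intro integrable_mult_right)
    show "AE t in half_line. (\<lambda>k. fin_p (N k) t powr (-1/2) - (fin_p (N k) t + W k * fin_m (N k) t) powr (-1/2))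
      \<longlonglongrightarrow> (2 * t) powr (-1/2) - (2 * t + w * (1 - exp (-t))) powr (-1/2)"
      using limpos by (intro AE_I2 tendsto_intros p m W) auto
    show "AE t in half_line. norm (fin_p (N k) t powr (-1/2) - (fin_p (N k) t + W k * fin_m (N k) t) powr (-1/2))
       \<le> B * (3 powr (3/2) * ((1 - exp (-t)) * (2 * t) powr (-3/2)))" for k
    proof (rule AE_I2)
      fix t assume t: "t \<in> space half_line"
      note pos = fin.p_pos[OF t, of k] fin.m_pos[OF t, of k]
      have "\<bar>fin_p (N k) t powr (-1/2) - (fin_p (N k) t + W k * fin_m (N k) t) powr (-1/2)\<bar>
          \<le> (fin_p (N k) t + W k * fin_m (N k) t - fin_p (N k) t) * fin_p (N k) t powr (-3/2)"
        using pos W(2)[of k] by (intro powr_minus_half_diff_le) auto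
      also have "\<dots> = W k * (fin_m (N k) t * fin_p (N k) t powr (-3/2))"
        by simp
      also have "\<dots> \<le> B * (3 powr (3/2) * ((1 - exp (-t)) * (2 * t) powr (-3/2)))"
        using weight[of t k] t pos W(2)[of k] B[of k]
        by (intro mult_mono[of _ B]) (auto intro: order_trans)
      finally show "norm (fin_p (N k) t powr (-1/2) - (fin_p (N k) t + W k * fin_m (N k) t) powr (-1/2))
         \<le> B * (3 powr (3/2) * ((1 - exp (-t)) * (2 * t) powr (-3/2)))" by simp
    qed
  qed (rule measurable_half_line; measurable)+
  then show "(\<lambda>k. fin_psi (N k) (W k)) \<longlonglongrightarrow> grazing.psi w"
    unfolding grazing.psi_def fin.psi_def by (intro tendsto_mult tendsto_const)
  have "(\<lambda>k. \<integral>t. fin_m (N k) t * (fin_p (N k) t + W k * fin_m (N k) t) powr (-3/2) \<partial>half_line)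
     \<longlonglongrightarrow> (\<integral>t. (1 - exp (-t)) * (2 * t + w * (1 - exp (-t))) powr (-3/2) \<partial>half_line)"
  proof (rule integral_dominated_convergence[where w = "\<lambda>t. 3 powr (3/2) * ((1 - exp (-t)) * (2 * t) powr (-3/2))"])
    show "AE t in half_line. (\<lambda>k. fin_m (N k) t * (fin_p (N k) t + W k * fin_m (N k) t) powr (-3/2))
      \<longlonglongrightarrow> (1 - exp (-t)) * (2 * t + w * (1 - exp (-t))) powr (-3/2)"
      using limpos by (intro AE_I2 tendsto_intros p m W) auto
    show "AE t in half_line. norm (fin_m (N k) t * (fin_p (N k) t + W k * fin_m (N k) t) powr (-3/2))
       \<le> 3 powr (3/2) * ((1 - exp (-t)) * (2 * t) powr (-3/2))" for k
    proof (rule AE_I2)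
      fix t assume t: "t \<in> space half_line"
      note pos = fin.p_pos[OF t, of k] fin.m_pos[OF t, of k]
      have "fin_m (N k) t * (fin_p (N k) t + W k * fin_m (N k) t) powr (-3/2)
         \<le> fin_m (N k) t * fin_p (N k) t powr (-3/2)"
        using pos W(2)[of k] by (intro mult_left_mono powr_mono2') auto
      also have "\<dots> \<le> 3 powr (3/2) * ((1 - exp (-t)) * (2 * t) powr (-3/2))"
        using weight[of t k] t by simp
      finally show "norm (fin_m (N k) t * (fin_p (N k) t + W k * fin_m (N k) t) powr (-3/2))
         \<le> 3 powr (3/2) * ((1 - exp (-t)) * (2 * t) powr (-3/2))"
        using pos by (simp add: abs_mult)
    qed
      show "integrable half_line (\<lambda>t. 3 powr (3/2) * ((1 - exp (-t)) * (2 * t) powr (-3/2)))"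
      using grazing.integrable_weight by (intro integrable_mult_right)
  qed (rule measurable_half_line; measurable)+
  then show "(\<lambda>k. fin_dpsi (N k) (W k)) \<longlonglongrightarrow> grazing.dpsi w"
    unfolding grazing.dpsi_def fin.dpsi_def .
qed

section \<open>From the potential to the deflection function\<close>

lemma x_zero_eqI:
  assumes "s > 1" "\<beta> > 0" "x > 0" "1 - x\<^sup>2 - (x / \<beta>) powr (s - 1) = 0"
  shows "x_zero s \<beta> = x"
proof -
  have less: "y\<^sup>2 + (y / \<beta>) powr (s - 1) < z\<^sup>2 + (z / \<beta>) powr (s - 1)" if "0 < y" "y < z" for y z
    using that assms by (intro add_strict_mono power_strict_mono powr_less_mono2 divide_strict_right_mono) auto
  have "(THE x. 0 < x \<and> 1 - x\<^sup>2 - (x / \<beta>) powr (s - 1) = 0) = x"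
  proof (rule the_equality)
    fix y assume y: "0 < y \<and> 1 - y\<^sup>2 - (y / \<beta>) powr (s - 1) = 0"
    show "y = x"
      using less[of x y] less[of y x] y assms(3,4) by (cases x y rule: linorder_cases) auto
  qed (use assms in auto)
  then show ?thesis
    using assms by (simp add: x_zero_def)
qed

lemma x_zero_props:
  assumes "s > 1" "\<beta> > 0"
  shows "0 < x_zero s \<beta>" "x_zero s \<beta> < 1"
    and "(x_zero s \<beta> / \<beta>) powr (s - 1) = 1 - (x_zero s \<beta>)\<^sup>2"
proof -
  have "\<exists>x\<ge>0. x \<le> 1 \<and> x\<^sup>2 + (x / \<beta>) powr (s - 1) = 1"
    using assms by (intro IVT') (auto intro!: continuous_intros continuous_on_powr')
  then obtain x where x: "0 \<le> x" "x \<le> 1" "x\<^sup>2 + (x / \<beta>) powr (s - 1) = 1" by blast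
  have "x \<noteq> 0" using x(3) by auto
  with x(1) have x0: "x > 0" by simp
  then have eq: "x_zero s \<beta> = x"
    using assms x by (intro x_zero_eqI) auto
  have "(x / \<beta>) powr (s - 1) > 0" using x0 assms by simp
  with x(3) have "x\<^sup>2 < 1" by linarith
  with x0 have "x < 1" by (simp add: power2_less_1_iff)
  then show "0 < x_zero s \<beta>" "x_zero s \<beta> < 1" "(x_zero s \<beta> / \<beta>) powr (s - 1) = 1 - (x_zero s \<beta>)\<^sup>2"
    using eq x0 x(3) by auto
qed

lemma powr_minus_half: "x > 0 \<Longrightarrow> x powr (-1/2) = 1 / sqrt x" for x :: real
  by (simp add: powr_minus_divide powr_half_sqrt)

lemma powr_minus_half_power2: "x > 0 \<Longrightarrow> (x powr (-1/2))\<^sup>2 = 1 / x" for x :: real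
  by (simp add: power2_eq_square powr_minus_divide flip: powr_add)

text \<open>
  The impact parameter as an elementary function of \<open>w = n (1 / x\<^sup>2 - 1)\<close>, where \<open>x\<close> is
  the positive root; it is \<open>x (1 - x\<^sup>2)^(- 1 / n)\<close> rewritten in terms of \<open>w\<close>. The scaling by \<open>n\<close>
  keeps \<open>w\<close> of order one for deflection angles of order \<open>1 / sqrt n\<close>.
\<close>

definition impact_of_param :: "real \<Rightarrow> real \<Rightarrow> real" where
  "impact_of_param n w = (1 + w / n) powr (1 / n - 1 / 2) * (w / n) powr (- 1 / n)"

definition param_of_impact :: "real \<Rightarrow> real \<Rightarrow> real" where
  "param_of_impact n \<beta> = n * (1 / (x_zero (n + 1) \<beta>)\<^sup>2 - 1)"

lemma impact_of_param_pos: "n > 0 \<Longrightarrow> w > 0 \<Longrightarrow> impact_of_param n w > 0"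
  using add_pos_pos[of 1 "w / n"] by (simp add: impact_of_param_def)

lemma param_of_impact_pos: "n > 0 \<Longrightarrow> \<beta> > 0 \<Longrightarrow> param_of_impact n \<beta> > 0"
  using x_zero_props(1,2)[of "n + 1" \<beta>]
  by (simp add: param_of_impact_def field_simps power_less_one_iff)

lemma x_zero_impact_of_param:
  assumes "n > 0" "w > 0"
  shows "x_zero (n + 1) (impact_of_param n w) = (1 + w / n) powr (-1/2)"
proof (rule x_zero_eqI)
  let ?v = "w / n" and ?x = "(1 + w / n) powr (-1/2)"
  have v: "?v > 0" "1 + ?v > 0" using assms by (auto intro: add_pos_pos)
  have x2: "?x\<^sup>2 = 1 / (1 + ?v)"
    using v(2) by (rule powr_minus_half_power2)
  have "?x / impact_of_param n w = (1 + ?v) powr (-1/n) * ?v powr (1/n)"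
  proof -
    have "(1 + ?v) powr (-1/n) * (1 + ?v) powr (1 / n - 1 / 2) = ?x"
      by (simp flip: powr_add)
    moreover have "?v powr (1/n) * ?v powr (-1/n) = 1"
      using v assms by (simp flip: powr_add)
    moreover have "(1 + ?v) powr (-1/n) * ?v powr (1/n) * impact_of_param n w
       = ((1 + ?v) powr (-1/n) * (1 + ?v) powr (1 / n - 1 / 2)) * (?v powr (1/n) * ?v powr (-1/n))"
      unfolding impact_of_param_def by (simp only: mult_ac)
    ultimately have "(1 + ?v) powr (-1/n) * ?v powr (1/n) * impact_of_param n w = ?x"
      by simp
    then show ?thesis
      using impact_of_param_pos[OF assms] by (simp add: field_simps)
  qed
  then have "(?x / impact_of_param n w) powr (n + 1 - 1) = (1 + ?v) powr (-1) * ?v"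
    using assms v by (simp add: powr_mult powr_powr)
  also have "\<dots> = ?v / (1 + ?v)"
    using v by (simp add: powr_minus divide_inverse)
  finally show "1 - ?x\<^sup>2 - (?x / impact_of_param n w) powr (n + 1 - 1) = 0"
    unfolding x2 using v by (simp add: field_simps)
  show "?x > 0" using v by simp
qed (use assms impact_of_param_pos in auto)

lemma param_of_impact_inverse:
  assumes "n > 0" "w > 0"
  shows "param_of_impact n (impact_of_param n w) = w"
proof -
  have "1 + w / n > 0" using assms by (auto intro: add_pos_pos)
  then have "((1 + w / n) powr (-1/2))\<^sup>2 = 1 / (1 + w / n)"
    by (rule powr_minus_half_power2)
  then show ?thesis
    using assms by (simp add: param_of_impact_def x_zero_impact_of_param)
qed

lemma impact_of_param_inverse:
  assumes "n > 0" "\<beta> > 0"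
  shows "impact_of_param n (param_of_impact n \<beta>) = \<beta>"
proof -
  define x where "x = x_zero (n + 1) \<beta>"
  have x: "0 < x" "(x / \<beta>) powr n = 1 - x\<^sup>2"
    using x_zero_props[of "n + 1" \<beta>] assms by (auto simp: x_def)
  have 1: "1 + param_of_impact n \<beta> / n = x powr (-2)"
    using assms x by (simp add: param_of_impact_def flip: x_def) (simp add: powr_minus divide_inverse)
  have "param_of_impact n \<beta> / n = (1 - x\<^sup>2) * x powr (-2)"
    using assms x by (simp add: param_of_impact_def flip: x_def) (simp add: powr_minus field_simps)
  then have 2: "param_of_impact n \<beta> / n = (x / \<beta>) powr n * x powr (-2)"
    using x by simp
  have "impact_of_param n (param_of_impact n \<beta>) = x powr (-2 * (1/n - 1/2)) * ((x / \<beta>) powr (-1) * x powr (2/n))"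
    unfolding impact_of_param_def using assms x(1) by (subst 1, subst 2) (simp add: powr_mult powr_powr)
  also have "\<dots> = (x powr (-2 * (1/n - 1/2)) * x powr (2/n)) * (\<beta> / x)"
    using assms x by (simp add: powr_minus field_simps)
  also have "x powr (-2 * (1/n - 1/2)) * x powr (2/n) = x"
    using x by (simp add: field_simps flip: powr_add)
  finally show ?thesis using x by simp
qed

text \<open>
  The logarithmic derivative is a difference of two fractions of order \<open>1 / n\<close>; combined over a common
  denominator it gives the numerator \<open>w + 2\<close> of the kernel.
\<close>

lemma impact_of_param_deriv:
  assumes "n > 0" "w > 0"
  shows "(impact_of_param n has_real_derivative - impact_of_param n w * (w + 2) / (2 * w * (n + w))) (at w)"
proof -
  let ?a = "1 + w / n" and ?b = "w / n"
  have pos: "?a > 0" "?b > 0" using assms by (auto intro: add_pos_pos)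
  have der: "(impact_of_param n has_real_derivative
      ((1 / n - 1 / 2) * ?a powr (1 / n - 1 / 2 - 1) * (1 / n)) * ?b powr (-1/n)
      + ((-1/n) * ?b powr (-1/n - 1) * (1 / n)) * ?a powr (1 / n - 1 / 2)) (at w)"
    unfolding impact_of_param_def [abs_def]
    by (rule DERIV_mult DERIV_fun_powr derivative_eq_intros refl pos | use assms in simp)+
  have "((1 / n - 1 / 2) * ?a powr (1 / n - 1 / 2 - 1) * (1 / n)) * ?b powr (-1/n)
      + ((-1/n) * ?b powr (-1/n - 1) * (1 / n)) * ?a powr (1 / n - 1 / 2)
     = impact_of_param n w * ((1 / n - 1 / 2) / ?a / n - 1 / n / ?b / n)"
    unfolding impact_of_param_def powr_diff[of ?a "1 / n - 1 / 2" 1] powr_diff[of ?b "-1 / n" 1] powr_one[OF less_imp_le[OF pos(1)]]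
      powr_one[OF less_imp_le[OF pos(2)]]
    by (simp only: divide_inverse) (simp only: algebra_simps)
  also have "(1 / n - 1 / 2) / ?a / n - 1 / n / ?b / n = - (w + 2) / (2 * w * (n + w))"
  proof -
    have "?a * n = n + w" "?b * n = w" using assms by (auto simp: field_simps)
    then have "(1 / n - 1 / 2) / ?a / n - 1 / n / ?b / n = (1 / n - 1 / 2) / (n + w) - 1 / n / w"
      by (simp only: divide_divide_eq_left mult.assoc)
    also have "\<dots> = - (w + 2) / (2 * w * (n + w))"
      using assms by (simp add: divide_simps) (simp add: algebra_simps)
    finally show ?thesis .
  qed
  also have "impact_of_param n w * (- (w + 2) / (2 * w * (n + w))) = - impact_of_param n w * (w + 2) / (2 * w * (n + w))"
    by (simp only: times_divide_eq_right mult_minus_left mult_minus_right)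
  finally have eq: "((1 / n - 1 / 2) * ?a powr (1 / n - 1 / 2 - 1) * (1 / n)) * ?b powr (-1/n)
      + ((-1/n) * ?b powr (-1/n - 1) * (1 / n)) * ?a powr (1 / n - 1 / 2)
     = - impact_of_param n w * (w + 2) / (2 * w * (n + w))" .
  show ?thesis using der unfolding eq .
qed

text \<open>
  This is the integral of \<open>1 / sqrt (1 - z\<^sup>2)\<close> over the unit interval in the variable
  \<open>z = exp (- t / n)\<close>. It supplies the \<open>pi\<close> in the definition of the deflection angle.
\<close>

lemma integral_fin_p:
  assumes "n > 0"
  shows "integrable half_line (\<lambda>t. fin_p n t powr (-1/2))"
    and "integral\<^sup>L half_line (\<lambda>t. fin_p n t powr (-1/2)) = sqrt n * (pi / 2)"
proof -
  let ?F = "\<lambda>t. sqrt n * arctan (sqrt (exp (2 * t / n) - 1))"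
  have lim: "(?F \<longlongrightarrow> 0) (at_right 0)" "(?F \<longlongrightarrow> sqrt n * (pi / 2)) at_top"
  proof -
    show "(?F \<longlongrightarrow> 0) (at_right 0)"
      using assms by real_asymp
    have "((\<lambda>t. arctan (sqrt (exp (2 * t / n) - 1))) \<longlongrightarrow> pi / 2) at_top"
      using assms by real_asymp
    then show "(?F \<longlongrightarrow> sqrt n * (pi / 2)) at_top"
      by (intro tendsto_intros)
  qed
  have der: "(?F has_real_derivative fin_p n t powr (-1/2)) (at t)"
    and cont: "isCont (\<lambda>t. fin_p n t powr (-1/2)) t" if t: "t > 0" for t
  proof -
    define E where "E = exp (2 * t / n) - 1"
    have E: "E > 0" using t assms by (simp add: E_def)
    have "sqrt n * (inverse (1 + (sqrt E)\<^sup>2) * (exp (2 * t / n) * (2 / n) * (inverse (sqrt E) / 2)))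
       = fin_p n t powr (-1/2)"
    proof -
      have e: "exp (2 * t / n) = 1 + E" "(sqrt E)\<^sup>2 = E"
        using E by (simp_all add: E_def)
      have "sqrt n * (i * (c * (2 / n) * (r / 2))) = (i * c) * (sqrt n / n * r)" for i c r
        by simp
      then have "sqrt n * (inverse (1 + (sqrt E)\<^sup>2) * (exp (2 * t / n) * (2 / n) * (inverse (sqrt E) / 2)))
        = (inverse (1 + E) * (1 + E)) * (sqrt n / n * inverse (sqrt E))"
        unfolding e .
      also have "inverse (1 + E) * (1 + E) = 1"
        using E by simp
      also have "1 * (sqrt n / n * inverse (sqrt E)) = 1 / sqrt (n * E)"
      proof -
        have "sqrt n / n = 1 / sqrt n" using assms by (simp add: real_div_sqrt field_simps)
        then show ?thesis by (simp add: real_sqrt_mult inverse_eq_divide)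
      qed
      also have "\<dots> = fin_p n t powr (-1/2)"
        using E assms unfolding fin_p_def E_def[symmetric] by (intro powr_minus_half[symmetric]) simp
      finally show ?thesis .
    qed
    then show "(?F has_real_derivative fin_p n t powr (-1/2)) (at t)"
      using E assms unfolding E_def
      by (auto intro!: derivative_eq_intros simp: mult_ac)
    have "isCont (\<lambda>t. (n * (exp (2 * t / n) - 1)) powr (-1/2)) t"
      using E assms unfolding E_def by (intro continuous_intros) auto
    then show "isCont (\<lambda>t. fin_p n t powr (-1/2)) t"
      by (simp add: fin_p_def)
  qed
  note FTC = half_line_FTC_nonneg[OF der cont _ lim]
  show "integrable half_line (\<lambda>t. fin_p n t powr (-1/2))"
    by (rule FTC(1)) auto
  have "integral\<^sup>L half_line (\<lambda>t. fin_p n t powr (-1/2)) = sqrt n * (pi / 2) - 0"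
    by (rule FTC(2)) auto
  then show "integral\<^sup>L half_line (\<lambda>t. fin_p n t powr (-1/2)) = sqrt n * (pi / 2)"
    by simp
qed

lemma integrable_fin:
  assumes "n \<ge> 2" "w \<ge> 0"
  shows "integrable half_line (\<lambda>t. (fin_p n t + w * fin_m n t) powr (-1/2))"
proof (rule integrable_half_line_bound[OF integral_fin_p(1)])
  interpret deflection half_line "fin_p n" "fin_m n"
    using assms(1) by (rule deflection_fin)
  fix t :: real assume "t > 0"
  then show "\<bar>(fin_p n t + w * fin_m n t) powr (-1/2)\<bar> \<le> fin_p n t powr (-1/2)"
    using p_pos[of t] m_pos[of t] assms by (auto intro!: powr_mono2')
qed (use assms in \<open>auto\<close>)

lemma fin_psi_eq:
  assumes "n \<ge> 2" "w \<ge> 0"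
  shows "fin_psi n w = sqrt n * pi - 2 * (\<integral>t. (fin_p n t + w * fin_m n t) powr (-1/2) \<partial>half_line)"
proof -
  interpret deflection half_line "fin_p n" "fin_m n"
    using assms(1) by (rule deflection_fin)
  show ?thesis
    unfolding psi_def
    using assms integrable_fin[OF assms] integral_fin_p[of n] by (simp add: algebra_simps)
qed

lemma fin_psi_less_pi:
  assumes "n \<ge> 2" "w \<ge> 0"
  shows "fin_psi n w < sqrt n * pi"
proof -
  interpret deflection half_line "fin_p n" "fin_m n"
    using assms(1) by (rule deflection_fin)
  \<comment> \<open>Monotonicity turns the weak bound at \<open>w + 1\<close> into a strict one at \<open>w\<close>.\<close>
  have "fin_psi n w < fin_psi n (w + 1)"
    using assms by (intro psi_strict_mono) auto
  also have "\<dots> \<le> sqrt n * pi"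
    unfolding fin_psi_eq[of n "w + 1", simplified, OF assms(1) add_nonneg_nonneg[OF assms(2) zero_le_one]]
    by (simp add: Bochner_Integration.integral_nonneg)
  finally show ?thesis .
qed

text \<open>
  The root equation gives \<open>(y / \<beta>)^n = (1 - x\<^sup>2) exp (-t)\<close> along \<open>y = x exp (- t / n)\<close>, and
  division of the radicand by \<open>x\<^sup>2\<close> makes it affine in \<open>1 / x\<^sup>2 - 1\<close>. The singular endpoint is
  moved to \<open>t = 0\<close>, and the domain of integration no longer depends on \<open>\<beta>\<close>.
\<close>

lemma deviation_angle_eq:
  assumes n: "n \<ge> 2" and \<beta>: "\<beta> > 0"
  shows "deviation_angle (n + 1) \<beta> = fin_psi n (param_of_impact n \<beta>) / sqrt n"
proof -
  define x w where "x = x_zero (n + 1) \<beta>" and "w = param_of_impact n \<beta>"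
  have x: "0 < x" "x < 1" "(x / \<beta>) powr n = 1 - x\<^sup>2"
    using x_zero_props[of "n + 1" \<beta>] n \<beta> by (auto simp: x_def)
  have w: "w > 0" "w = n * (1 / x\<^sup>2 - 1)"
    using param_of_impact_pos[of n \<beta>] n \<beta> by (auto simp: w_def param_of_impact_def x_def)
  define f where "f = (\<lambda>y. 1 / sqrt (1 - y\<^sup>2 - (y / \<beta>) powr n))"
  define g where "g = (\<lambda>t. x * exp (- t / n))"
  define g' where "g' = (\<lambda>t. - (x / n) * exp (- t / n))"
  define h where "h = (\<lambda>t. (fin_p n t + w * fin_m n t) powr (-1/2) / sqrt n)"
  have image: "g ` {0<..} = {0<..<x}"
  proof (intro equalityI subsetI)
    fix y assume y: "y \<in> {0<..<x}"
    then have "ln (x / y) > 0" using x by simp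
    then show "y \<in> g ` {0<..}"
      using y x n by (intro image_eqI[of _ _ "n * ln (x / y)"]) (auto simp: g_def exp_minus)
  qed (use x n in \<open>auto simp: g_def\<close>)
  have inj: "inj_on g {0<..}"
    using x n by (auto simp: inj_on_def g_def)
  have subst: "\<bar>g' t\<bar> * f (g t) = h t" if t: "t > 0" for t
  proof -
    define e q where "e = exp (t / n)" and "q = exp (- t)"
    have e: "e > 0" "exp (- t / n) = 1 / e" "exp (2 * t / n) = e\<^sup>2"
      by (auto simp: e_def exp_minus divide_inverse power2_eq_square simp flip: exp_add)
    define R where "R = 1 - x\<^sup>2 / e\<^sup>2 - (1 - x\<^sup>2) * q"
    have "g t / \<beta> = (x / \<beta>) * exp (- t / n)"
      by (simp add: g_def)
    then have "(g t / \<beta>) powr n = (x / \<beta>) powr n * exp (- t / n) powr n"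
      using x(1) \<beta> by (simp only: powr_mult)
    also have "exp (- t / n) powr n = q"
      using n by (simp add: exp_powr_real q_def)
    finally have "1 - (g t)\<^sup>2 - (g t / \<beta>) powr n = R"
      using x e by (simp add: R_def g_def power_mult_distrib power_divide)
    then have 1: "\<bar>g' t\<bar> * f (g t) = x / (n * e * sqrt R)"
      using x n e by (simp add: g'_def f_def abs_mult)
    \<comment> \<open>The radicand, up to the factor \<open>n (e / x)\<^sup>2\<close>, is the affine function of \<open>w\<close> in the deflection integral.\<close>
    have 2: "fin_p n t + w * fin_m n t = n * (e / x)\<^sup>2 * R"
      unfolding fin_p_def fin_m_def e q_def[symmetric] w R_def
      using x e(1) by (simp add: field_simps power2_eq_square)
    have "fin_p n t + w * fin_m n t > 0"
    proof -
      interpret deflection half_line "fin_p n" "fin_m n"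
        using n by (rule deflection_fin)
      show ?thesis
        using p_pos[of t] m_pos[of t] w t by (auto intro!: add_pos_pos)
    qed
    then have "h t = 1 / (sqrt (n * (e / x)\<^sup>2 * R) * sqrt n)"
      by (simp only: h_def powr_minus_half divide_divide_eq_left 2)
    also have "sqrt (n * (e / x)\<^sup>2 * R) * sqrt n = (sqrt n * sqrt n) * sqrt ((e / x)\<^sup>2) * sqrt R"
      by (simp only: real_sqrt_mult mult_ac)
    also have "\<dots> = n * (e / x) * sqrt R"
      using n x e(1) by simp
    also have "1 / (n * (e / x) * sqrt R) = x / (n * e * sqrt R)"
      using x by simp
    finally show ?thesis using 1 by simp
  qed
  have h_int: "set_integrable lborel {0<..} h"
    using integrable_fin[of n w] n w unfolding integrable_half_line_iff[symmetric] h_def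
    by (intro integrable_divide) auto
  have h_integral: "integral {0<..} h = (\<integral>t. h t \<partial>half_line)"
    using set_borel_integral_eq_integral(2)[OF h_int] by (simp add: integral_half_line_eq)
  have "h absolutely_integrable_on {0<..}"
    using set_borel_integral_eq_integral(1)[OF h_int] n
    by (intro nonnegative_absolutely_integrable_1) (auto simp: h_def)
  then have "(\<lambda>t. \<bar>g' t\<bar> * f (g t)) absolutely_integrable_on {0<..}"
    by (subst set_integrable_cong[OF refl refl subst]) auto
  moreover have "integral {0<..} (\<lambda>t. \<bar>g' t\<bar> * f (g t)) = (\<integral>t. h t \<partial>half_line)"
    unfolding h_integral[symmetric] by (intro integral_cong subst) auto
  moreover have "(g has_real_derivative g' t) (at t within {0<..})" for t
    unfolding g_def g'_def using n by (auto intro!: derivative_eq_intros)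
  ultimately have "integral (g ` {0<..}) f = (\<integral>t. h t \<partial>half_line)"
    using has_absolute_integral_change_of_variables_1'[of "{0<..}" g g' f "\<integral>t. h t \<partial>half_line"] inj
    by auto
  then have "phi_zero (n + 1) \<beta> = (\<integral>t. h t \<partial>half_line)"
    unfolding phi_zero_def x_def[symmetric] integral_open_interval_real image
    by (simp add: f_def)
  also have "\<dots> = (\<integral>t. (fin_p n t + w * fin_m n t) powr (-1/2) \<partial>half_line) / sqrt n"
    unfolding h_def by simp
  finally show ?thesis
    using fin_psi_eq[of n w] n w by (simp add: deviation_angle_def w_def[symmetric] diff_divide_distrib)
qed

section \<open>The kernel in terms of the deflection function\<close>

lemma deviation_angle_0: "deviation_angle s 0 = pi"
  by (simp add: deviation_angle_def phi_zero_def x_zero_def)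

lemma deviation_angle_inj:
  assumes n: "n \<ge> 2"
  shows "inj_on (deviation_angle (n + 1)) {0..}"
proof -
  interpret deflection half_line "fin_p n" "fin_m n"
    using n by (rule deflection_fin)
  let ?F = "deviation_angle (n + 1)"
  have less: "?F \<beta> < pi" if "\<beta> > 0" for \<beta>
    using fin_psi_less_pi[of n "param_of_impact n \<beta>"] param_of_impact_pos[of n \<beta>] that n
    by (simp add: deviation_angle_eq divide_less_eq mult.commute)
  have inj: "\<beta> = \<beta>'" if "\<beta> > 0" "\<beta>' > 0" "?F \<beta> = ?F \<beta>'" for \<beta> \<beta>'
  proof -
    have "fin_psi n (param_of_impact n \<beta>) = fin_psi n (param_of_impact n \<beta>')"
      using that n by (simp add: deviation_angle_eq)
    then have "param_of_impact n \<beta> = param_of_impact n \<beta>'"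
      using param_of_impact_pos[of n \<beta>] param_of_impact_pos[of n \<beta>'] that n by (subst (asm) psi_eq_iff) auto
    then have "impact_of_param n (param_of_impact n \<beta>) = impact_of_param n (param_of_impact n \<beta>')"
      by (rule arg_cong)
    moreover have "impact_of_param n (param_of_impact n \<beta>) = \<beta>" "impact_of_param n (param_of_impact n \<beta>') = \<beta>'"
      using that(1,2) n by (auto intro!: impact_of_param_inverse)
    ultimately show ?thesis by (simp only:)
  qed
  show ?thesis
  proof (rule inj_onI)
    fix \<beta> \<beta>' :: real assume *: "\<beta> \<in> {0..}" "\<beta>' \<in> {0..}" "?F \<beta> = ?F \<beta>'"
    show "\<beta> = \<beta>'"
      using * less[of \<beta>] less[of \<beta>'] inj[of \<beta> \<beta>'] deviation_angle_0[of "n + 1"]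
      by (cases "\<beta> = 0"; cases "\<beta>' = 0") auto
  qed
qed

lemma impact_parameter_deviation_angle:
  assumes "n \<ge> 2" "\<beta> \<ge> 0"
  shows "impact_parameter (n + 1) (deviation_angle (n + 1) \<beta>) = \<beta>"
  unfolding impact_parameter_def using assms by (intro the_inv_into_f_f deviation_angle_inj) auto

lemma deviation_angle_impact_of_param:
  assumes "n \<ge> 2" "w > 0"
  shows "deviation_angle (n + 1) (impact_of_param n w) = fin_psi n w / sqrt n"
  using assms impact_of_param_pos[of n w] by (simp add: deviation_angle_eq param_of_impact_inverse)

lemma deviation_angle_deriv:
  assumes n: "n \<ge> 2" and w: "w > 0"
  shows "(deviation_angle (n + 1) has_real_derivative
           fin_dpsi n w * inverse (- impact_of_param n w * (w + 2) / (2 * w * (n + w))) / sqrt n) (at (impact_of_param n w))"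
proof -
  interpret deflection half_line "fin_p n" "fin_m n"
    using n by (rule deflection_fin)
  have "(param_of_impact n has_real_derivative inverse (- impact_of_param n w * (w + 2) / (2 * w * (n + w)))) (at (impact_of_param n w))"
  proof (rule has_field_derivative_inverse_strong[where S = "{0<..}" and f = "impact_of_param n" and x = w])
    show "(impact_of_param n has_real_derivative - impact_of_param n w * (w + 2) / (2 * w * (n + w))) (at w)"
      using n w by (intro impact_of_param_deriv) auto
    show "continuous_on {0<..} (impact_of_param n)"
      using n by (intro continuous_at_imp_continuous_on ballI DERIV_isCont[OF impact_of_param_deriv]) auto
    show "param_of_impact n (impact_of_param n v) = v" if "v \<in> {0<..}" for v
      using n that by (intro param_of_impact_inverse) auto
    show "- impact_of_param n w * (w + 2) / (2 * w * (n + w)) \<noteq> 0"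
      using impact_of_param_pos[of n w] n w by simp
  qed (use w in auto)
  then have "((\<lambda>\<beta>. psi (param_of_impact n \<beta>)) has_real_derivative
      dpsi w * inverse (- impact_of_param n w * (w + 2) / (2 * w * (n + w)))) (at (impact_of_param n w))"
    using psi_deriv[of w] w n by (intro DERIV_chain2) (simp_all add: param_of_impact_inverse)
  then have "((\<lambda>\<beta>. psi (param_of_impact n \<beta>) / sqrt n) has_real_derivative
      dpsi w * inverse (- impact_of_param n w * (w + 2) / (2 * w * (n + w))) / sqrt n) (at (impact_of_param n w))"
    by (rule DERIV_cdivide)
  then show ?thesis
    by (rule has_field_derivative_transform_within_open[where S = "{0<..}"])
       (use impact_of_param_pos[of n w] deviation_angle_eq n w in auto)
qed

text \<open>
  Parametrised by \<open>w\<close>, both the angle and the impact parameter are explicit, so the derivative of the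
  inverse function becomes a quotient of derivatives in \<open>w\<close>.
\<close>

lemma kernel_formula_eq:
  assumes n: "n \<ge> 2" and w: "w > 0"
  shows "kernel_formula (n + 1) (fin_psi n w / sqrt n) =
    2 powr (4 / n) * (impact_of_param n w)\<^sup>2 * (w + 2) /
      (2 * w * (1 + w / n) * (sqrt n * sin (fin_psi n w / sqrt n)) * fin_dpsi n w)"
proof -
  interpret deflection half_line "fin_p n" "fin_m n"
    using n by (rule deflection_fin)
  let ?F = "deviation_angle (n + 1)"
  \<comment> \<open>The impact parameter decreases in \<open>w\<close>, hence the negative derivative \<open>D\<close>.\<close>
  define b where "b = impact_of_param n w"
  define D where "D = - b * (w + 2) / (2 * w * (n + w))"
  have b: "b > 0" using impact_of_param_pos[of n w] n w by (simp add: b_def)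
  have dpos: "dpsi w > 0" using dpsi_pos[of w] w by simp
  have D: "D < 0" unfolding D_def using b n w by (intro divide_neg_pos mult_neg_pos) auto
  have Fb: "?F b = psi w / sqrt n" "impact_parameter (n + 1) (psi w / sqrt n) = b"
    using deviation_angle_impact_of_param[OF n w] impact_parameter_deviation_angle[OF n, of b] b
    by (simp_all add: b_def)
  have "(impact_parameter (n + 1) has_real_derivative inverse (dpsi w * inverse D / sqrt n)) (at (?F b))"
  proof (rule has_field_derivative_inverse_strong[where S = "{0<..}" and f = ?F and x = b])
    show "(?F has_real_derivative dpsi w * inverse D / sqrt n) (at b)"
      using deviation_angle_deriv[OF n w] by (simp only: b_def D_def)
    show "continuous_on {0<..} ?F"
    proof (intro continuous_at_imp_continuous_on ballI)
      fix \<beta> :: real assume "\<beta> \<in> {0<..}"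
      then show "isCont ?F \<beta>"
        using DERIV_isCont[OF deviation_angle_deriv[OF n param_of_impact_pos[of n \<beta>]]] impact_of_param_inverse[of n \<beta>] n
        by simp
    qed
    show "impact_parameter (n + 1) (?F \<beta>) = \<beta>" if "\<beta> \<in> {0<..}" for \<beta>
      using impact_parameter_deviation_angle[OF n, of \<beta>] that by simp
    show "dpsi w * inverse D / sqrt n \<noteq> 0"
      using dpos D n by simp
  qed (use b in auto)
  then have "deriv (impact_parameter (n + 1)) (psi w / sqrt n) = D * sqrt n / dpsi w"
    unfolding Fb by (subst DERIV_imp_deriv) (auto simp: field_simps)
  then have "\<bar>deriv (impact_parameter (n + 1)) (psi w / sqrt n)\<bar> = (- D * sqrt n) / dpsi w"
    using D dpos n by (simp add: abs_mult)
  moreover have "- D * sqrt n = b * (w + 2) / (2 * w * (1 + w / n) * sqrt n)"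
  proof -
    have "2 * w * (n + w) = 2 * w * (1 + w / n) * (sqrt n * sqrt n)"
      using n by (simp add: field_simps)
    also have "\<dots> = (2 * w * (1 + w / n) * sqrt n) * sqrt n"
      by (simp only: mult.assoc)
    finally have "- D = b * (w + 2) / ((2 * w * (1 + w / n) * sqrt n) * sqrt n)"
      by (simp add: D_def)
    also have "\<dots> * sqrt n = b * (w + 2) / (2 * w * (1 + w / n) * sqrt n)"
      using n by (simp only: times_divide_eq_left) simp
    finally show ?thesis .
  qed
  ultimately have "\<bar>deriv (impact_parameter (n + 1)) (psi w / sqrt n)\<bar> =
      b * (w + 2) / (2 * w * (1 + w / n) * sqrt n) / dpsi w"
    by (simp only:)
  then show ?thesis
    unfolding kernel_formula_def Fb by (simp add: b_def power2_eq_square mult_ac)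
qed

lemma angular_kernel_cos:
  assumes "0 < u" "u < pi"
  shows "angular_kernel s (cos u) = kernel_formula s u"
proof -
  have "arccos (cos u) = u"
    using assms by (intro arccos_cos) auto
  moreover from this have "cos u \<noteq> -1"
    using assms arccos_minus_1 by auto
  ultimately show ?thesis
    by (simp add: angular_kernel_def)
qed

section \<open>The grazing limit for large parameters\<close>

text \<open>
  The substitution \<open>t = w u\<close> moves all dependence on \<open>w\<close> into the factor \<open>1 - exp (- w u)\<close>, which
  tends to \<open>1\<close>.
\<close>

lemma sqrt_mult_grazing_dpsi:
  assumes w: "w > 0"
  shows "sqrt w * grazing.dpsi w =
    (\<integral>t. (1 - exp (- (w * t))) * (2 * t + (1 - exp (- (w * t)))) powr (-3/2) \<partial>half_line)"
proof -
  let ?f = "\<lambda>t. (1 - exp (-t)) * (2 * t + w * (1 - exp (-t))) powr (-3/2)"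
  let ?g = "\<lambda>t. (1 - exp (- (w * t))) * (2 * t + (1 - exp (- (w * t)))) powr (-3/2)"
  have "grazing.dpsi w = w * (\<integral>t. ?f (w * t) \<partial>half_line)"
    using half_line_scale(1)[OF w, of ?f] w by (simp add: grazing.dpsi_def)
  also have "(\<integral>t. ?f (w * t) \<partial>half_line) = (\<integral>t. w powr (-3/2) * ?g t \<partial>half_line)"
  proof (intro Bochner_Integration.integral_cong refl)
    fix t :: real assume "t \<in> space half_line"
    then have "2 * t + (1 - exp (- (w * t))) \<ge> 0" using w by simp
    moreover have "2 * (w * t) + w * (1 - exp (- (w * t))) = w * (2 * t + (1 - exp (- (w * t))))"
      by (simp only: algebra_simps)
    ultimately show "?f (w * t) = w powr (-3/2) * ?g t"
      using w by (simp only: powr_mult less_imp_le mult_ac)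
  qed
  also have "\<dots> = w powr (-3/2) * (\<integral>t. ?g t \<partial>half_line)"
    by (rule integral_mult_right_zero)
  finally have "sqrt w * grazing.dpsi w = (w powr (1/2) * w powr 1 * w powr (-3/2)) * (\<integral>t. ?g t \<partial>half_line)"
    using w by (simp add: powr_half_sqrt)
  also have "w powr (1/2) * w powr 1 * w powr (-3/2) = 1"
    using w by (simp only: powr_add[symmetric]) simp
  finally show ?thesis by simp
qed

lemma grazing_dpsi_asymp: "((\<lambda>w. sqrt w * grazing.dpsi w) \<longlongrightarrow> 1) at_top"
proof -
  let ?g = "\<lambda>w t. (1 - exp (- (w * t))) * (2 * t + (1 - exp (- (w * t)))) powr (-3/2) :: real"
  have "((\<lambda>w. \<integral>t. ?g w t \<partial>half_line) \<longlongrightarrow> (\<integral>t. 1 * (2 * t + 1) powr (-3/2) \<partial>half_line)) at_top"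
  proof (rule integral_dominated_convergence_at_top)
    show "(\<lambda>t. 1 * (2 * t + 1) powr (-3/2)) \<in> borel_measurable half_line"
      "?g w \<in> borel_measurable half_line" for w :: real
      by (rule measurable_half_line; measurable)+
    show "integrable half_line (\<lambda>t. 2 * (t powr (-1/2) / (1 + t)))"
      using integrable_majorant by (intro integrable_mult_right)
    show "AE t in half_line. ((\<lambda>w. ?g w t) \<longlongrightarrow> 1 * (2 * t + 1) powr (-3/2)) at_top"
    proof (rule AE_I2)
      fix t :: real assume "t \<in> space half_line"
      then have t: "t > 0" by simp
      have "((\<lambda>w. 1 - exp (- (w * t))) \<longlongrightarrow> 1) at_top"
        using t by real_asymp
      then show "((\<lambda>w. ?g w t) \<longlongrightarrow> 1 * (2 * t + 1) powr (-3/2)) at_top"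
        using t by (intro tendsto_intros) auto
    qed
    show "\<forall>\<^sub>F w in at_top. AE t in half_line. norm (?g w t) \<le> 2 * (t powr (-1/2) / (1 + t))"
      using eventually_gt_at_top[of 0]
    proof eventually_elim
      case (elim w)
      show ?case
      proof (rule AE_I2)
        fix t :: real assume "t \<in> space half_line"
        then have t: "t > 0" by simp
        \<comment> \<open>Both branches of the majorant: drop \<open>y\<close> from the base, or absorb the factor \<open>y\<close> into it.\<close>
        define y where "y = 1 - exp (- (w * t))"
        have y: "0 < y" "y \<le> 1" using t elim by (auto simp: y_def)
        have "y * (2 * t + y) powr (-3/2) \<le> 1 * t powr (-3/2)"
          using t y by (intro mult_mono powr_mono2') auto
        moreover have "y * (2 * t + y) powr (-3/2) \<le> t powr (-1/2)"
        proof -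
          have "y * (2 * t + y) powr (-3/2) \<le> (2 * t + y) powr 1 * (2 * t + y) powr (-3/2)"
            using t y by (intro mult_right_mono) auto
          also have "\<dots> = (2 * t + y) powr (-1/2)"
            by (simp only: powr_add[symmetric]) simp
          also have "\<dots> \<le> t powr (-1/2)"
            using t y by (intro powr_mono2') auto
          finally show ?thesis .
        qed
        ultimately have "y * (2 * t + y) powr (-3/2) \<le> 2 * (t powr (-1/2) / (1 + t))"
          using t by (intro min_le_majorant) auto
        then show "norm (?g w t) \<le> 2 * (t powr (-1/2) / (1 + t))"
          using y by (simp add: y_def[symmetric] abs_mult)
      qed
    qed
  qed
  moreover have "(\<integral>t. 1 * (2 * t + 1) powr (-3/2) \<partial>half_line) = 0 - (-1 :: real)"
  proof (rule half_line_FTC_nonneg)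
    show "((\<lambda>t. - ((2 * t + 1) powr (-1/2))) \<longlongrightarrow> 0) (at_top :: real filter)"
      by real_asymp
    show "((\<lambda>t. - ((2 * t + 1) powr (-1/2))) \<longlongrightarrow> -1) (at_right (0::real))"
      by real_asymp
    show "((\<lambda>t. - ((2 * t + 1) powr (-1/2))) has_real_derivative 1 * (2 * t + 1) powr (-3/2)) (at t)"
      if "t > 0" for t :: real
      using that by (auto intro!: derivative_eq_intros)
    show "isCont (\<lambda>t. 1 * (2 * t + 1) powr (-3/2)) t" if "t > 0" for t :: real
      using that by (intro continuous_intros) auto
  qed auto
  ultimately have "((\<lambda>w. \<integral>t. ?g w t \<partial>half_line) \<longlongrightarrow> 1) at_top"
    by simp
  moreover have "\<forall>\<^sub>F w in at_top. (\<integral>t. ?g w t \<partial>half_line) = sqrt w * grazing.dpsi w"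
    using eventually_gt_at_top[of 0] by eventually_elim (rule sqrt_mult_grazing_dpsi[symmetric])
  ultimately show ?thesis
    by (rule Lim_transform_eventually)
qed

text \<open>
  By l'Hospital's rule from the asymptotics of the derivative.
\<close>

lemma grazing_psi_asymp: "((\<lambda>w. grazing.psi w / (2 * sqrt w)) \<longlongrightarrow> 1) at_top"
proof (rule lhospital_at_top_at_top)
  show "filterlim (\<lambda>w::real. 2 * sqrt w) at_top at_top"
    by real_asymp
  show "\<forall>\<^sub>F w::real in at_top. 1 / sqrt w \<noteq> 0"
    using eventually_gt_at_top[of 0] by eventually_elim auto
  show "\<forall>\<^sub>F w in at_top. (grazing.psi has_real_derivative grazing.dpsi w) (at w)"
    using eventually_gt_at_top[of 0] by eventually_elim (auto intro: grazing.psi_deriv)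
  show "\<forall>\<^sub>F w::real in at_top. ((\<lambda>w. 2 * sqrt w) has_real_derivative 1 / sqrt w) (at w)"
    using eventually_gt_at_top[of 0]
    by eventually_elim (auto intro!: derivative_eq_intros simp: field_simps)
  show "((\<lambda>w. grazing.dpsi w / (1 / sqrt w)) \<longlongrightarrow> 1) at_top"
    using grazing_dpsi_asymp by (simp add: mult.commute)
qed

lemma filterlim_grazing_psi_at_top: "filterlim grazing.psi at_top at_top"
proof -
  have "filterlim (\<lambda>w. grazing.psi w / (2 * sqrt w) * (2 * sqrt w)) at_top at_top"
    by (rule filterlim_tendsto_pos_mult_at_top[OF grazing_psi_asymp]) (simp, real_asymp)
  moreover have "\<forall>\<^sub>F w in at_top. grazing.psi w / (2 * sqrt w) * (2 * sqrt w) = grazing.psi w"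
    using eventually_gt_at_top[of "0::real"] by eventually_elim simp
  ultimately show ?thesis
    by (rule filterlim_mono_eventually[OF _ order_refl order_refl])
qed

section \<open>The inverse of the limiting deflection function\<close>

definition grazing_inv :: "real \<Rightarrow> real" where
  "grazing_inv y = (THE w. w > 0 \<and> grazing.psi w = y)"

lemma grazing_inv_psi: "w > 0 \<Longrightarrow> grazing_inv (grazing.psi w) = w"
  unfolding grazing_inv_def by (rule the_equality) (auto simp: grazing.psi_eq_iff)

lemma grazing_inv:
  assumes "y > 0"
  shows "grazing_inv y > 0" "grazing.psi (grazing_inv y) = y"
proof -
  have "\<forall>\<^sub>F w in at_top. y < grazing.psi w \<and> w > 0"
    using filterlim_grazing_psi_at_top eventually_gt_at_top[of "0::real"]
    by (auto simp: filterlim_at_top_dense eventually_conj_iff)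
  then obtain b where "y < grazing.psi b" "b > 0"
    using eventually_happens[of _ "at_top :: real filter"] by auto
  then obtain w where "w > 0" "grazing.psi w = y"
    using grazing.psi_IVT[of 0 b y] assms grazing.psi_0 by auto
  then show "grazing_inv y > 0" "grazing.psi (grazing_inv y) = y"
    using grazing_inv_psi[of w] by auto
qed

lemma grazing_inv_less_iff:
  assumes "y > 0" "w > 0"
  shows "grazing_inv y < w \<longleftrightarrow> y < grazing.psi w" "w < grazing_inv y \<longleftrightarrow> grazing.psi w < y"
  using grazing.psi_less_iff[of "grazing_inv y" w] grazing.psi_less_iff[of w "grazing_inv y"] grazing_inv[OF assms(1)] assms(2)
  by auto

lemma isCont_grazing_inv:
  assumes "y > 0"
  shows "isCont grazing_inv y"
proof -
  have "(grazing_inv has_real_derivative inverse (grazing.dpsi (grazing_inv y))) (at (grazing.psi (grazing_inv y)))"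
  proof (rule has_field_derivative_inverse_strong[where S = "{0<..}" and f = grazing.psi and x = "grazing_inv y"])
    show "continuous_on {0<..} grazing.psi"
      by (intro continuous_at_imp_continuous_on ballI grazing.isCont_psi) auto
    show "(grazing.psi has_real_derivative grazing.dpsi (grazing_inv y)) (at (grazing_inv y))"
      using grazing_inv[OF assms] by (intro grazing.psi_deriv) auto
    show "grazing.dpsi (grazing_inv y) \<noteq> 0"
      using grazing.dpsi_pos[of "grazing_inv y"] grazing_inv[OF assms] by simp
  qed (use grazing_inv[OF assms] grazing_inv_psi in auto)
  then show ?thesis
    using DERIV_isCont grazing_inv[OF assms] by auto
qed

lemma filterlim_grazing_inv_at_top: "filterlim grazing_inv at_top at_top"
  unfolding filterlim_at_top_dense
proof
  fix M :: real
  have M: "max M 1 > 0" by simp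
  have "\<forall>\<^sub>F y in at_top. max 0 (grazing.psi (max M 1)) < y"
    by (rule eventually_gt_at_top)
  then show "\<forall>\<^sub>F y in at_top. M < grazing_inv y"
  proof eventually_elim
    case (elim y)
    then show ?case
      using grazing_inv_less_iff(2)[of y "max M 1"] by auto
  qed
qed

lemma filterlim_grazing_inv_at_right_0: "filterlim grazing_inv (at_right 0) (at_right 0)"
  unfolding filterlim_at
proof
  show pos: "\<forall>\<^sub>F y in at_right 0. grazing_inv y \<in> {0<..} \<and> grazing_inv y \<noteq> 0"
    using eventually_at_right_less[of "0::real"] 
  proof eventually_elim
    case (elim y)
    then show ?case using grazing_inv(1)[of y] by simp
  qed
  show "(grazing_inv \<longlongrightarrow> 0) (at_right 0)"
  proof (rule order_tendstoI)
    fix a :: real assume a: "a < 0"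
    show "\<forall>\<^sub>F y in at_right 0. a < grazing_inv y"
      using pos by eventually_elim (use a in auto)
  next
    fix a :: real assume a: "0 < a"
    then have "\<forall>\<^sub>F y in at_right 0. y < grazing.psi a"
      using grazing.psi_pos[OF a] by (intro order_tendstoD(2)[OF tendsto_ident_at])
    then show "\<forall>\<^sub>F y in at_right 0. grazing_inv y < a"
      using eventually_at_right_less[of "0::real"]
      by eventually_elim (use a grazing_inv_less_iff in auto)
  qed
qed

section \<open>The limit kernel\<close>

text \<open>
  The limit kernel along the curve \<open>w \<mapsto> psi w\<close>: the limit of the right-hand side in
  \<open>kernel_formula_eq\<close>.
\<close>

definition grazing_curve :: "real \<Rightarrow> real" where
  "grazing_curve w = (w + 2) / (2 * w * grazing.psi w * grazing.dpsi w)"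

definition grazing_kernel :: "real \<Rightarrow> real" where
  "grazing_kernel y = grazing_curve (grazing_inv y)"

lemma grazing_curve_at_top: "(grazing_curve \<longlongrightarrow> 1 / 4) at_top"
proof -
  have "((\<lambda>w. (1 + 2 / w) / (4 * (grazing.psi w / (2 * sqrt w)) * (sqrt w * grazing.dpsi w))) \<longlongrightarrow> 1 / (4 * 1 * 1)) at_top"
    by (intro tendsto_intros grazing_psi_asymp grazing_dpsi_asymp) (real_asymp, simp)
  moreover have "\<forall>\<^sub>F w in at_top. (1 + 2 / w) / (4 * (grazing.psi w / (2 * sqrt w)) * (sqrt w * grazing.dpsi w)) = grazing_curve w"
    using eventually_gt_at_top[of 0]
  proof eventually_elim
    case (elim w)
    then have "4 * (grazing.psi w / (2 * sqrt w)) * (sqrt w * grazing.dpsi w) = 2 * grazing.psi w * grazing.dpsi w"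
      by simp
    moreover have "1 + 2 / w = (w + 2) / w" using elim by (simp add: field_simps)
    ultimately show ?case by (simp add: grazing_curve_def mult_ac)
  qed
  ultimately have "(grazing_curve \<longlongrightarrow> 1 / (4 * 1 * 1)) at_top"
    by (rule Lim_transform_eventually)
  then show ?thesis by simp
qed

lemma grazing_kernel_at_top: "(grazing_kernel \<longlongrightarrow> 1 / 4) at_top"
  unfolding grazing_kernel_def [abs_def]
  by (rule filterlim_compose[OF grazing_curve_at_top filterlim_grazing_inv_at_top])

section \<open>Locally uniform convergence of the kernels\<close>

text \<open>
  Continuous convergence implies uniform convergence on compact sets: a sequence of points violating
  uniformity has a convergent subsequence.
\<close>

lemma uniform_limit_compactI_sequentially:
  fixes f :: "real \<Rightarrow> 'a::metric_space \<Rightarrow> 'b::metric_space"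
  assumes K: "compact K" and g: "continuous_on K g"
    and lim: "\<And>S X x. filterlim S at_top sequentially \<Longrightarrow> (\<And>k::nat. X k \<in> K) \<Longrightarrow> X \<longlonglongrightarrow> x \<Longrightarrow> x \<in> K
      \<Longrightarrow> (\<lambda>k. f (S k) (X k)) \<longlonglongrightarrow> g x"
  shows "uniform_limit K f g at_top"
proof (rule ccontr)
  assume "\<not> ?thesis"
  then obtain e where e: "e > 0" "\<not> (\<forall>\<^sub>F s in at_top. \<forall>x\<in>K. dist (f s x) (g x) < e)"
    unfolding uniform_limit_iff by blast
  then have "\<forall>r. \<exists>s\<ge>r. \<exists>x\<in>K. e \<le> dist (f s x) (g x)"
    by (simp add: eventually_at_top_linorder not_less)
  then have "\<exists>s\<ge>real k. \<exists>x\<in>K. e \<le> dist (f s x) (g x)" for k :: nat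
    by blast
  then obtain S X where SX: "\<And>k. S k \<ge> real k" "\<And>k. X k \<in> K" "\<And>k. e \<le> dist (f (S k) (X k)) (g (X k))"
    by metis
  obtain x r where r: "x \<in> K" "strict_mono (r :: nat \<Rightarrow> nat)" "(X \<circ> r) \<longlonglongrightarrow> x"
    using K SX(2) unfolding compact_def by metis
  have "filterlim S at_top sequentially"
    by (rule filterlim_at_top_mono[OF filterlim_real_sequentially]) (use SX(1) in auto)
  then have "filterlim (\<lambda>k. S (r k)) at_top sequentially"
    using filterlim_compose filterlim_subseq[OF r(2)] by blast
  then have 1: "(\<lambda>k. f (S (r k)) (X (r k))) \<longlonglongrightarrow> g x"
    using r SX(2) by (intro lim) (auto simp: o_def)
  have 2: "(\<lambda>k. g (X (r k))) \<longlonglongrightarrow> g x"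
    using continuous_on_tendsto_compose[OF g r(3) r(1)] SX(2) by (simp add: o_def)
  have "(\<lambda>k. dist (f (S (r k)) (X (r k))) (g (X (r k)))) \<longlonglongrightarrow> dist (g x) (g x)"
    by (intro tendsto_dist 1 2)
  then have "\<forall>\<^sub>F k in sequentially. dist (f (S (r k)) (X (r k))) (g (X (r k))) < e"
    using e(1) by (intro order_tendstoD(2)) auto
  then obtain k where "dist (f (S (r k)) (X (r k))) (g (X (r k))) < e"
    using eventually_happens[of _ sequentially] by auto
  with SX(3)[of "r k"] show False by simp
qed

text \<open>
  The second factor is \<open>exp ((ln N - ln W) / N)\<close>, so it tends to \<open>1\<close> because \<open>ln N / N\<close> tends to \<open>0\<close>.
\<close>

lemma impact_of_param_tendsto_1:
  fixes N W :: "nat \<Rightarrow> real"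
  assumes N: "filterlim N at_top sequentially" and W: "W \<longlonglongrightarrow> w" "w > 0"
  shows "(\<lambda>k. impact_of_param (N k) (W k)) \<longlonglongrightarrow> 1"
proof -
  have inv: "(\<lambda>k. 1 / N k) \<longlonglongrightarrow> 0"
    by (rule filterlim_compose[OF _ N]) real_asymp
  have lnN: "(\<lambda>k. ln (N k) / N k) \<longlonglongrightarrow> 0"
    by (rule filterlim_compose[OF _ N]) real_asymp
  have "(\<lambda>k. (1 + W k * (1 / N k)) powr (1 / N k - 1 / 2)) \<longlonglongrightarrow> (1 + w * 0) powr (0 - 1 / 2)"
    by (intro tendsto_intros inv W) auto
  then have 1: "(\<lambda>k. (1 + W k / N k) powr (1 / N k - 1 / 2)) \<longlonglongrightarrow> 1"
    by simp
  have "(\<lambda>k. exp (ln (N k) / N k - ln (W k) * (1 / N k))) \<longlonglongrightarrow> exp (0 - ln w * 0)"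
    using W by (intro tendsto_intros inv lnN) auto
  moreover have "\<forall>\<^sub>F k in sequentially. exp (ln (N k) / N k - ln (W k) * (1 / N k)) = (W k / N k) powr (- 1 / N k)"
    using order_tendstoD(1)[OF W] filterlim_at_top_dense[THEN iffD1, OF N, rule_format, of 0]
  proof eventually_elim
    case (elim k)
    then show ?case
      by (simp add: powr_def ln_div field_simps)
  qed
  ultimately have "(\<lambda>k. (W k / N k) powr (- 1 / N k)) \<longlonglongrightarrow> exp (0 - ln w * 0)"
    by (rule Lim_transform_eventually)
  from tendsto_mult[OF 1 this] show ?thesis
    by (simp add: impact_of_param_def)
qed

lemma sqrt_mult_sin_tendsto:
  fixes N Y :: "nat \<Rightarrow> real"
  assumes N: "filterlim N at_top sequentially" and Y: "Y \<longlonglongrightarrow> y" "y > 0"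
  shows "(\<lambda>k. sqrt (N k) * sin (Y k / sqrt (N k))) \<longlonglongrightarrow> y"
proof -
  have "(\<lambda>k. 1 / sqrt (N k)) \<longlonglongrightarrow> 0"
    by (rule filterlim_compose[OF _ N]) real_asymp
  from tendsto_mult[OF Y(1) this] have u: "(\<lambda>k. Y k / sqrt (N k)) \<longlonglongrightarrow> 0"
    by simp
  have ev: "\<forall>\<^sub>F k in sequentially. Y k > 0 \<and> N k > 0"
    using order_tendstoD(1)[OF Y] filterlim_at_top_dense[THEN iffD1, OF N, rule_format, of 0]
    by eventually_elim auto
  have "((\<lambda>x::real. sin x / x) \<longlongrightarrow> 1) (at 0)"
    by real_asymp
  moreover have "filterlim (\<lambda>k. Y k / sqrt (N k)) (at 0) sequentially"
    using u ev by (intro filterlim_atI) (auto elim: eventually_mono)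
  ultimately have "(\<lambda>k. sin (Y k / sqrt (N k)) / (Y k / sqrt (N k))) \<longlonglongrightarrow> 1"
    by (rule filterlim_compose)
  from tendsto_mult[OF Y(1) this]
  have "(\<lambda>k. Y k * (sin (Y k / sqrt (N k)) / (Y k / sqrt (N k)))) \<longlonglongrightarrow> y"
    by simp
  moreover have "\<forall>\<^sub>F k in sequentially. Y k * (sin (Y k / sqrt (N k)) / (Y k / sqrt (N k))) = sqrt (N k) * sin (Y k / sqrt (N k))"
    using ev by eventually_elim auto
  ultimately show ?thesis
    by (rule Lim_transform_eventually)
qed

text \<open>
  Strict monotonicity makes convergence of the inverse functions automatic: the values at
  \<open>w - e\<close> and \<open>w + e\<close> eventually lie on the two sides of \<open>Y k\<close>, so the solution is trapped between.
\<close>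

lemma fin_psi_inverse_tendsto:
  fixes N Y :: "nat \<Rightarrow> real"
  assumes N: "filterlim N at_top sequentially" "\<And>k. N k \<ge> 2"
    and Y: "Y \<longlonglongrightarrow> y" "y > 0"
  obtains W where "W \<longlonglongrightarrow> grazing_inv y" "\<And>k. W k > 0"
    "\<forall>\<^sub>F k in sequentially. fin_psi (N k) (W k) = Y k"
proof -
  interpret fin: deflection half_line "fin_p (N k)" "fin_m (N k)" for k
    using N(2) by (rule deflection_fin)
  define w where "w = grazing_inv y"
  have w: "w > 0" "grazing.psi w = y"
    using grazing_inv[OF Y(2)] by (auto simp: w_def)
  \<comment> \<open>Solutions are only known to exist from some index on; elsewhere the limit serves as a placeholder.\<close>
  define W where "W = (\<lambda>k. if \<exists>v>0. fin_psi (N k) v = Y k then SOME v. v > 0 \<and> fin_psi (N k) v = Y k else w)"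
  have W: "W k > 0 \<and> fin_psi (N k) (W k) = Y k" if "\<exists>v>0. fin_psi (N k) v = Y k" for k
    using someI_ex[of "\<lambda>v. v > 0 \<and> fin_psi (N k) v = Y k"] that by (simp add: W_def)
  have near: "\<forall>\<^sub>F k in sequentially. \<bar>W k - w\<bar> < e \<and> fin_psi (N k) (W k) = Y k"
    if e: "0 < e" "e < w" for e
  proof -
    have "(\<lambda>k. fin_psi (N k) (w - e) - Y k) \<longlonglongrightarrow> grazing.psi (w - e) - y"
      "(\<lambda>k. fin_psi (N k) (w + e) - Y k) \<longlonglongrightarrow> grazing.psi (w + e) - y"
      using e by (intro tendsto_intros Y fin_psi_tendsto N; simp)+
    moreover have "grazing.psi (w - e) - y < 0" "0 < grazing.psi (w + e) - y"
      using grazing.psi_strict_mono[of "w - e" w] grazing.psi_strict_mono[of w "w + e"] e w by auto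
    ultimately have "\<forall>\<^sub>F k in sequentially. fin_psi (N k) (w - e) - Y k < 0"
      "\<forall>\<^sub>F k in sequentially. 0 < fin_psi (N k) (w + e) - Y k"
      using order_tendstoD by blast+
    then show ?thesis
    proof eventually_elim
      case (elim k)
      obtain v where v: "w - e < v" "v < w + e" "fin_psi (N k) v = Y k"
        using fin.psi_IVT[of "w - e" "w + e" k "Y k"] elim e by auto
      then have Wk: "W k > 0 \<and> fin_psi (N k) (W k) = Y k"
        using e by (intro W exI[of _ v]) auto
      then have "W k = v"
        using fin.psi_eq_iff[of "W k" v k] v e by auto
      then show ?case using v Wk by auto
    qed
  qed
  show ?thesis
  proof (rule that[of W])
    show "W \<longlonglongrightarrow> grazing_inv y"
      unfolding w_def[symmetric] tendsto_iff dist_real_def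
    proof (intro allI impI)
      fix e :: real assume "e > 0"
      then have "0 < min e (w / 2)" "min e (w / 2) < w"
        using w by auto
      from near[OF this] show "\<forall>\<^sub>F k in sequentially. \<bar>W k - w\<bar> < e"
        by eventually_elim auto
    qed
    show "W k > 0" for k
      using W[of k] w by (cases "\<exists>v>0. fin_psi (N k) v = Y k") (auto simp: W_def)
    show "\<forall>\<^sub>F k in sequentially. fin_psi (N k) (W k) = Y k"
      using near[of "w / 2"] w by (auto elim: eventually_mono)
  qed
qed

text \<open>
  The angle \<open>X / sqrt S\<close> is written as \<open>Y / sqrt N\<close> with \<open>N = S - 1\<close>, which is the scaling
  in which the deflection angle is \<open>fin_psi N w / sqrt N\<close>; the ratio of the two scalings tends to \<open>1\<close>.
\<close>

lemma angular_kernel_tendsto: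
  fixes S X :: "nat \<Rightarrow> real"
  assumes S: "filterlim S at_top sequentially" and X: "X \<longlonglongrightarrow> x" "x > 0"
  shows "(\<lambda>k. angular_kernel (S k) (cos (X k / sqrt (S k)))) \<longlonglongrightarrow> grazing_kernel x"
proof -
  \<comment> \<open>The maximum makes the bound \<open>N \<ge> 2\<close> hold for every index; eventually \<open>N k = S k - 1\<close>.\<close>
  define N where "N = (\<lambda>k. max 2 (S k - 1))"
  define Y where "Y = (\<lambda>k. X k * sqrt (N k / (N k + 1)))"
  have N2: "N k \<ge> 2" for k by (simp add: N_def)
  have "filterlim (\<lambda>k. S k - 1) at_top sequentially"
    by (rule filterlim_compose[OF _ S]) real_asymp
  then have N: "filterlim N at_top sequentially"
    by (rule filterlim_at_top_mono) (simp add: N_def)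
  have "(\<lambda>k. sqrt (N k / (N k + 1))) \<longlonglongrightarrow> 1"
    by (rule filterlim_compose[OF _ N]) real_asymp
  from tendsto_mult[OF X(1) this] have Y: "Y \<longlonglongrightarrow> x"
    by (simp add: Y_def)
  obtain W where W: "W \<longlonglongrightarrow> grazing_inv x" "\<And>k. W k > 0"
    "\<forall>\<^sub>F k in sequentially. fin_psi (N k) (W k) = Y k"
    using fin_psi_inverse_tendsto[OF N N2 Y X(2)] by blast
  define w where "w = grazing_inv x"
  have w: "w > 0" "grazing.psi w = x" using grazing_inv[OF X(2)] by (auto simp: w_def)
  note Ww = W(1)[folded w_def]
  let ?R = "\<lambda>k. 2 powr (4 / N k) * (impact_of_param (N k) (W k))\<^sup>2 * (W k + 2) /
      (2 * W k * (1 + W k / N k) * (sqrt (N k) * sin (fin_psi (N k) (W k) / sqrt (N k))) * fin_dpsi (N k) (W k))"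
  have inv: "(\<lambda>k. 1 / N k) \<longlonglongrightarrow> 0"
    by (rule filterlim_compose[OF _ N]) real_asymp
  have 1: "(\<lambda>k. 2 powr (4 / N k)) \<longlonglongrightarrow> 1"
    by (rule filterlim_compose[OF _ N]) real_asymp
  have 2: "(\<lambda>k. 1 + W k / N k) \<longlonglongrightarrow> 1"
    using tendsto_add[OF tendsto_const[of 1] tendsto_mult[OF Ww inv]] by simp
  have W0: "W k \<ge> 0" for k using W(2)[of k] by simp
  have psi: "(\<lambda>k. fin_psi (N k) (W k)) \<longlonglongrightarrow> x" "(\<lambda>k. fin_dpsi (N k) (W k)) \<longlonglongrightarrow> grazing.dpsi w"
    using fin_psi_tendsto[OF N N2 Ww W0] w by auto
  have "?R \<longlonglongrightarrow> 1 * 1\<^sup>2 * (w + 2) / (2 * w * 1 * x * grazing.dpsi w)"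
    using w X(2) grazing.dpsi_pos[of w]
    by (intro tendsto_intros 1 2 psi Ww impact_of_param_tendsto_1[OF N Ww] sqrt_mult_sin_tendsto[OF N]) auto
  also have "1 * 1\<^sup>2 * (w + 2) / (2 * w * 1 * x * grazing.dpsi w) = grazing_kernel x"
    by (simp add: grazing_kernel_def grazing_curve_def w_def[symmetric] w)
  finally have "?R \<longlonglongrightarrow> grazing_kernel x" .
  moreover have "\<forall>\<^sub>F k in sequentially. ?R k = angular_kernel (S k) (cos (X k / sqrt (S k)))"
    using W(3) filterlim_at_top_dense[THEN iffD1, OF S, rule_format, of 3]
  proof eventually_elim
    case (elim k)
    interpret fin: deflection half_line "fin_p (N k)" "fin_m (N k)"
      using N2 by (rule deflection_fin)
    have Sk: "S k = N k + 1" using elim by (simp add: N_def)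
    have u: "fin_psi (N k) (W k) / sqrt (N k) = X k / sqrt (N k + 1)"
      using elim(1) N2[of k] by (simp add: Y_def real_sqrt_divide)
    have "angular_kernel (S k) (cos (X k / sqrt (S k))) =
        kernel_formula (N k + 1) (fin_psi (N k) (W k) / sqrt (N k))"
      unfolding Sk u[symmetric]
    proof (rule angular_kernel_cos)
      show "0 < fin_psi (N k) (W k) / sqrt (N k)"
        using fin.psi_pos[OF W(2)] N2[of k] by simp
      show "fin_psi (N k) (W k) / sqrt (N k) < pi"
        using fin_psi_less_pi[OF N2 W0, of k k] N2[of k] by (simp add: divide_less_eq mult.commute)
    qed
    then show ?case
      using kernel_formula_eq[OF N2 W(2), of k k] by simp
  qed
  ultimately show ?thesis
    by (rule Lim_transform_eventually)
qed

section \<open>Analyticity of the limit kernel\<close>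

text \<open>
  The real parts of the complex Taylor coefficients serve as real coefficients, since the powers of
  \<open>y - x\<close> are real.
\<close>

lemma real_analytic_onI_holomorphic:
  assumes "\<And>x. x \<in> S \<Longrightarrow> \<exists>H r. 0 < r \<and> H holomorphic_on ball (complex_of_real x) r \<and>
             (\<forall>y\<in>ball x r. H (of_real y) = of_real (f y))"
  shows "real_analytic_on f S"
  unfolding real_analytic_on_def
proof
  fix x assume "x \<in> S"
  then obtain H r where r: "0 < r" and H: "H holomorphic_on ball (complex_of_real x) r"
    and eq: "\<And>y. y \<in> ball x r \<Longrightarrow> H (of_real y) = of_real (f y)"
    using assms by metis
  let ?c = "\<lambda>n. (deriv ^^ n) H (of_real x) / fact n"
  have "(\<lambda>n. Re (?c n) * (y - x) ^ n) sums f y" if y: "y \<in> ball x r" for y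
  proof -
    have "(\<lambda>n. ?c n * (of_real y - of_real x) ^ n) sums H (of_real y)"
      using y by (intro holomorphic_power_series[OF H]) (simp add: dist_norm flip: of_real_diff)
    from sums_Re[OF this] have "(\<lambda>n. Re (?c n * of_real ((y - x) ^ n))) sums f y"
      unfolding eq[OF y] by (simp only: of_real_power of_real_diff Re_complex_of_real)
    moreover have "Re (?c n * of_real ((y - x) ^ n)) = Re (?c n) * (y - x) ^ n" for n
      by (subst mult.commute) (simp only: scaleR_conv_of_real[symmetric] scaleR_complex.simps mult.commute)
    ultimately show ?thesis by (simp only:)
  qed
  then show "\<exists>a r. 0 < r \<and> (\<forall>y\<in>ball x r. (\<lambda>n. a n * (y - x) ^ n) sums f y)"
    using r by (intro exI[of _ "\<lambda>n. Re (?c n)"] exI[of _ r]) auto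
qed

text \<open>
  Near each point the derivative of the holomorphic extension of \<open>psi\<close> is nonzero, so it has a
  holomorphic local inverse; on the real axis this agrees with the real inverse by continuity of the latter.
\<close>

lemma grazing_kernel_analytic: "real_analytic_on grazing_kernel {0<..}"
proof (rule real_analytic_onI_holomorphic)
  fix y0 :: real assume "y0 \<in> {0<..}"
  then have y0: "y0 > 0" by simp
  define w0 where "w0 = grazing_inv y0"
  have w0: "w0 > 0" "grazing.psi w0 = y0"
    using grazing_inv[OF y0] by (auto simp: w0_def)
  \<comment> \<open>Restricting to positive real part keeps the denominator \<open>g y\<close> away from \<open>0\<close>.\<close>
  define P where "P = {z. Re z > 0}"
  have P: "open P" "P \<subseteq> grazing.half_plane" "of_real w0 \<in> P"
    using w0 by (auto simp: P_def grazing.half_plane_def open_halfspace_Re_gt)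
  have hol: "grazing.cpsi holomorphic_on P" "grazing.cdpsi holomorphic_on P"
    using grazing.cpsi_holomorphic grazing.cdpsi_holomorphic P(2) by (auto intro: holomorphic_on_subset)
  have "deriv grazing.cpsi (of_real w0) \<noteq> 0"
    using P w0 grazing.dpsi_pos[of w0] by (subst grazing.deriv_cpsi) (auto simp: grazing.cdpsi_of_real)
  then obtain r where r: "r > 0" "ball (of_real w0) r \<subseteq> P" "inj_on grazing.cpsi (ball (of_real w0) r)"
    using has_complex_derivative_locally_injective[OF hol(1) P(3,1)] by blast
  let ?B = "ball (complex_of_real w0) r"
  have holB: "grazing.cpsi holomorphic_on ?B"
    using hol r by (blast intro: holomorphic_on_subset)
  obtain g where g: "g holomorphic_on (grazing.cpsi ` ?B)"
    "\<And>z. z \<in> ?B \<Longrightarrow> deriv grazing.cpsi z * deriv g (grazing.cpsi z) = 1"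
    "\<And>z. z \<in> ?B \<Longrightarrow> g (grazing.cpsi z) = z"
    using holomorphic_has_inverse[OF holB open_ball r(3)] by blast
  define V where "V = grazing.cpsi ` ?B - {0}"
  have "open (grazing.cpsi ` ?B)"
    by (rule open_mapping_thm3[OF holB open_ball r(3)])
  then have V: "open V" unfolding V_def by (intro open_Diff) auto
  have y0V: "of_real y0 \<in> V"
    using w0 y0 r(1) grazing.cpsi_of_real[of w0] unfolding V_def by (auto intro!: image_eqI[of _ _ "of_real w0"])
  have gV: "g y \<in> P" "grazing.cdpsi (g y) \<noteq> 0" if yV: "y \<in> V" for y
  proof -
    obtain z where z: "z \<in> ?B" "y = grazing.cpsi z" using yV unfolding V_def by blast
    then show "g y \<in> P" using g(3) r(2) by auto
    have "z \<in> grazing.half_plane" using z r(2) P(2) by auto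
    then show "grazing.cdpsi (g y) \<noteq> 0"
      using g(2)[OF z(1)] g(3)[OF z(1)] z(2) grazing.deriv_cpsi[of z] by auto
  qed
  define H where "H = (\<lambda>y. (g y + 2) / (2 * g y * y * grazing.cdpsi (g y)))"
  have gV_hol: "g holomorphic_on V"
    using g(1) by (rule holomorphic_on_subset) (auto simp: V_def)
  have "H holomorphic_on V"
    unfolding H_def
  proof (intro holomorphic_intros gV_hol)
    show "(\<lambda>y. grazing.cdpsi (g y)) holomorphic_on V"
      using holomorphic_on_compose_gen[OF gV_hol hol(2)] gV(1) by (auto simp: o_def)
    show "2 * g y * y * grazing.cdpsi (g y) \<noteq> 0" if "y \<in> V" for y
      using gV[OF that] that by (auto simp: V_def P_def)
  qed
  moreover obtain r1 where r1: "r1 > 0" "ball (of_real y0) r1 \<subseteq> V"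
    using V y0V open_contains_ball by blast
  moreover obtain r2 where r2: "r2 > 0" "\<And>y. dist y y0 < r2 \<Longrightarrow> dist (grazing_inv y) w0 < r"
    using isCont_grazing_inv[OF y0] r(1) unfolding continuous_at_eps_delta w0_def by (auto simp: dist_real_def)
  define \<rho> where "\<rho> = min r1 (min r2 y0)"
  have "H (of_real y) = of_real (grazing_kernel y)" if "y \<in> ball y0 \<rho>" for y
  proof -
    have "y > 0" "dist y y0 < r2"
      using that by (auto simp: \<rho>_def dist_real_def)
    define w where "w = grazing_inv y"
    have w: "w > 0" "grazing.psi w = y" using grazing_inv[OF \<open>y > 0\<close>] by (auto simp: w_def)
    have "of_real w \<in> ?B"
      using r2(2)[OF \<open>dist y y0 < r2\<close>] by (simp add: w_def dist_commute)
    then have gy: "g (of_real y) = of_real w"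
      using g(3)[of "of_real w"] w grazing.cpsi_of_real[of w] by simp
    have "H (of_real y) = of_real ((w + 2) / (2 * w * y * grazing.dpsi w))"
      unfolding H_def gy using w grazing.cdpsi_of_real[of w] by simp
    then show ?thesis
      by (simp add: grazing_kernel_def grazing_curve_def w w_def[symmetric])
  qed
  moreover have "\<rho> > 0" using r1 r2 y0 by (simp add: \<rho>_def)
  moreover have "ball (complex_of_real y0) \<rho> \<subseteq> V" using r1(2) by (auto simp: \<rho>_def)
  ultimately show "\<exists>H r. 0 < r \<and> H holomorphic_on ball (complex_of_real y0) r \<and>
             (\<forall>y\<in>ball y0 r. H (of_real y) = of_real (grazing_kernel y))"
    by (blast intro: holomorphic_on_subset)
qed

lemma isCont_grazing_kernel:
  assumes "y > 0"
  shows "isCont grazing_kernel y"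
  unfolding grazing_kernel_def [abs_def]
proof (rule isCont_o2[OF isCont_grazing_inv[OF assms]])
  note w = grazing_inv[OF assms]
  show "isCont grazing_curve (grazing_inv y)"
    unfolding grazing_curve_def [abs_def] using w assms grazing.dpsi_pos[of "grazing_inv y"]
    by (intro continuous_intros grazing.isCont_psi grazing.isCont_dpsi) auto
qed

section \<open>The singularity of the limit kernel at angle zero\<close>

lemma holomorphic_divided_difference:
  assumes f: "f holomorphic_on S" and S: "open S"
  obtains q where "q holomorphic_on S" "\<And>z. z \<in> S \<Longrightarrow> f z = f 0 + z * q z"
proof
  let ?q = "\<lambda>z. if z = 0 then deriv f 0 else (f z - f 0) / (z - 0)"
  show "?q holomorphic_on S" by (rule pole_lemma_open[OF f S])
  show "f z = f 0 + z * ?q z" for z by simp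
qed

text \<open>
  Taylor's formula with holomorphic remainders, both for \<open>f\<close> and for \<open>f'\<close>. Dividing out
  \<open>z\<close> three times gives the remainder of \<open>f\<close>, and differentiating the formula gives that of \<open>f'\<close>;
  the coefficients are then identified by uniqueness of derivatives.
\<close>

lemma holomorphic_second_order_expansion:
  assumes f: "f holomorphic_on S" and S: "open S" "0 \<in> S"
    and f': "\<And>z. z \<in> S \<Longrightarrow> (f has_field_derivative f' z) (at z)"
    and f'': "(f' has_field_derivative f'') (at 0)"
  obtains R T where "R holomorphic_on S" "T holomorphic_on S"
    "\<And>z. z \<in> S \<Longrightarrow> f z = f 0 + z * (f' 0 + z * (f'' / 2 + z * R z))"
    "\<And>z. z \<in> S \<Longrightarrow> f' z = f' 0 + z * (f'' + z * T z)"
proof -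
  obtain q1 where q1: "q1 holomorphic_on S" "\<And>z. z \<in> S \<Longrightarrow> f z = f 0 + z * q1 z"
    using holomorphic_divided_difference[OF f S(1)] by blast
  obtain q2 where q2: "q2 holomorphic_on S" "\<And>z. z \<in> S \<Longrightarrow> q1 z = q1 0 + z * q2 z"
    using holomorphic_divided_difference[OF q1(1) S(1)] by blast
  obtain R where R: "R holomorphic_on S" "\<And>z. z \<in> S \<Longrightarrow> q2 z = q2 0 + z * R z"
    using holomorphic_divided_difference[OF q2(1) S(1)] by blast
  define T where "T = (\<lambda>z. 3 * R z + z * deriv R z)"
  have T: "T holomorphic_on S"
    unfolding T_def using R(1) S(1) by (intro holomorphic_intros) auto
  have f_eq: "f z = f 0 + z * (q1 0 + z * (q2 0 + z * R z))" if "z \<in> S" for z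
    using q1(2) q2(2) R(2) that by simp
  have f'_eq: "f' z = q1 0 + z * (2 * q2 0 + z * T z)" if z: "z \<in> S" for z
  proof (rule DERIV_unique[OF f'[OF z]])
    have "(R has_field_derivative deriv R z) (at z)"
      using R(1) S(1) z by (rule holomorphic_derivI)
    then have "((\<lambda>z. f 0 + z * (q1 0 + z * (q2 0 + z * R z))) has_field_derivative
        q1 0 + z * (2 * q2 0 + z * T z)) (at z)"
      by (auto intro!: derivative_eq_intros simp: T_def algebra_simps)
    then show "(f has_field_derivative q1 0 + z * (2 * q2 0 + z * T z)) (at z)"
      by (rule has_field_derivative_transform_within_open[OF _ S(1) z]) (use f_eq in auto)
  qed
  have "f'' = 2 * q2 0"
  proof (rule DERIV_unique[OF f''])
    have "(T has_field_derivative deriv T 0) (at 0)"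
      using T S by (intro holomorphic_derivI)
    then have "((\<lambda>z. q1 0 + z * (2 * q2 0 + z * T z)) has_field_derivative 2 * q2 0) (at 0)"
      by (auto intro!: derivative_eq_intros)
    then show "(f' has_field_derivative 2 * q2 0) (at 0)"
      by (rule has_field_derivative_transform_within_open[OF _ S]) (use f'_eq in auto)
  qed
  moreover have "f' 0 = q1 0" using f'_eq[OF S(2)] by simp
  ultimately show ?thesis
    using that[OF R(1) T] f_eq f'_eq by simp
qed

lemma grazing_psi_expansion:
  defines "a \<equiv> sqrt (pi / 2)" and "b \<equiv> - sqrt pi / 2 * (1 - 1 / sqrt 2)"
  obtains r1 r2 :: "real \<Rightarrow> real" and l1 l2
  where "\<And>w. w > 0 \<Longrightarrow> grazing.psi w = w * (a + b * w + w\<^sup>2 * r1 w)"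
    "\<And>w. w > 0 \<Longrightarrow> grazing.dpsi w = a + 2 * b * w + w\<^sup>2 * r2 w"
    "(r1 \<longlongrightarrow> l1) (at_right 0)" "(r2 \<longlongrightarrow> l2) (at_right 0)"
proof -
  have 0: "0 \<in> grazing.half_plane" by (simp add: grazing.half_plane_def)
  obtain R T where RT: "R holomorphic_on grazing.half_plane" "T holomorphic_on grazing.half_plane"
    "\<And>z. z \<in> grazing.half_plane \<Longrightarrow> grazing.cpsi z = grazing.cpsi 0 + z * (grazing.cdpsi 0 + z * (grazing.cddpsi 0 / 2 + z * R z))"
    "\<And>z. z \<in> grazing.half_plane \<Longrightarrow> grazing.cdpsi z = grazing.cdpsi 0 + z * (grazing.cddpsi 0 + z * T z)"
    using holomorphic_second_order_expansion[OF grazing.cpsi_holomorphic grazing.half_plane(1) 0 grazing.cpsi_deriv grazing.cdpsi_deriv[OF 0]]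
    by blast
  have c: "grazing.cpsi 0 = 0" "grazing.cdpsi 0 = of_real a" "grazing.cddpsi 0 = of_real (2 * b)"
    using grazing.cpsi_of_real[of 0] grazing.cdpsi_of_real[of 0] grazing.psi_0 grazing_dpsi_0 grazing_cddpsi_0
    by (auto simp: a_def b_def)
  have tendsto: "((\<lambda>w. Re (F (of_real w))) \<longlongrightarrow> Re (F 0)) (at_right (0::real))"
    if F: "F holomorphic_on grazing.half_plane" for F
  proof -
    have "isCont F (of_real 0)"
      using holomorphic_on_imp_continuous_on[OF F] grazing.half_plane(1) 0
      by (simp add: continuous_on_eq_continuous_at)
    then have "isCont (\<lambda>w. F (of_real w)) 0"
      by (intro isCont_o2[where f = of_real and g = F]) auto
    then have "isCont (\<lambda>w. Re (F (of_real w))) 0"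
      by (rule bounded_linear.isCont[OF bounded_linear_Re])
    then show ?thesis
      by (simp add: isCont_def filterlim_at_split)
  qed
  show ?thesis
  proof (rule that[OF _ _ tendsto[OF RT(1)] tendsto[OF RT(2)]])
    fix w :: real assume w: "w > 0"
    then have wdom: "of_real w \<in> grazing.half_plane" by (simp add: grazing.half_plane_def)
    have "complex_of_real (grazing.psi w) = of_real w * (of_real a + of_real w * (of_real b + of_real w * R (of_real w)))"
      using RT(3)[OF wdom] grazing.cpsi_of_real[of w] w c by simp
    then have "grazing.psi w = Re (of_real w * (of_real a + of_real w * (of_real b + of_real w * R (of_real w))))"
      by (metis Re_complex_of_real)
    then show "grazing.psi w = w * (a + b * w + w\<^sup>2 * Re (R (of_real w)))"
      by (simp add: power2_eq_square algebra_simps)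
    have "complex_of_real (grazing.dpsi w) = of_real a + of_real w * (of_real (2 * b) + of_real w * T (of_real w))"
      using RT(4)[OF wdom] grazing.cdpsi_of_real[of w] w c by simp
    then have "grazing.dpsi w = Re (of_real a + of_real w * (of_real (2 * b) + of_real w * T (of_real w)))"
      by (metis Re_complex_of_real)
    then show "grazing.dpsi w = a + 2 * b * w + w\<^sup>2 * Re (T (of_real w))"
      by (simp add: power2_eq_square algebra_simps)
  qed
qed

text \<open>
  With \<open>psi w = w A\<close> and \<open>psi' w = B\<close>, the common numerator is \<open>w * (a - 2 b - 2 k a\<^sup>2)\<close> plus terms
  carrying a factor \<open>w\<^sup>2\<close>. The hypothesis on \<open>k\<close> removes the first term, and the factor
  \<open>w\<^sup>2\<close> cancels against the denominator, leaving an expression without singularity at \<open>w = 0\<close>.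
\<close>

lemma grazing_curve_remainder:
  fixes w a b k r1 r2 :: real
  defines "A \<equiv> a + b * w + w\<^sup>2 * r1" and "B \<equiv> a + 2 * b * w + w\<^sup>2 * r2"
  assumes "w > 0" "A \<noteq> 0" "B \<noteq> 0" and k: "a - 2 * b = 2 * k * a\<^sup>2"
  shows "(w + 2) / (2 * w * (w * A) * B) - 1 / (w * A)\<^sup>2 - k * (1 / (w * A)) =
    (b + 2 * r1 - 2 * r2 + w * r1 - 2 * k * (a * (2 * b + w * r2) + (b + w * r1) * B)) / (2 * A\<^sup>2 * B)"
    (is "?L = ?X / _")
proof -
  have "?L = ((w + 2) * A - 2 * B - 2 * k * w * A * B) / (w\<^sup>2 * (2 * A\<^sup>2 * B))"
    using assms(3-5) by (simp add: field_simps power2_eq_square)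
  also have "(w + 2) * A - 2 * B - 2 * k * w * A * B = w * (a - 2 * b - 2 * k * a\<^sup>2) + w\<^sup>2 * ?X"
    unfolding A_def B_def by (simp add: algebra_simps power2_eq_square)
  also have "\<dots> = w\<^sup>2 * ?X" using k by simp
  finally show ?thesis using assms(3) by simp
qed

lemma grazing_curve_at_0:
  obtains L where "((\<lambda>w. grazing_curve w - 1 / (grazing.psi w)\<^sup>2 - 1 / sqrt pi * (1 / grazing.psi w)) \<longlongrightarrow> L) (at_right 0)"
proof -
  define a b k where "a = sqrt (pi / 2)" and "b = - sqrt pi / 2 * (1 - 1 / sqrt 2)" and "k = 1 / sqrt pi"
  obtain r1 r2 l1 l2 where r: "\<And>w. w > 0 \<Longrightarrow> grazing.psi w = w * (a + b * w + w\<^sup>2 * r1 w)"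
    "\<And>w. w > 0 \<Longrightarrow> grazing.dpsi w = a + 2 * b * w + w\<^sup>2 * r2 w"
    "(r1 \<longlongrightarrow> l1) (at_right 0)" "(r2 \<longlongrightarrow> l2) (at_right 0)"
    using grazing_psi_expansion unfolding a_def b_def by metis
  have a: "a > 0" by (simp add: a_def)
  \<comment> \<open>This relation between the Taylor coefficients determines the coefficient \<open>1 / sqrt pi\<close>.\<close>
  have k: "a - 2 * b = 2 * k * a\<^sup>2"
  proof -
    have "2 * k * a\<^sup>2 = pi / sqrt pi" by (simp add: a_def k_def)
    also have "\<dots> = sqrt pi" by (simp add: real_div_sqrt)
    also have "\<dots> = a - 2 * b" by (simp add: a_def b_def real_sqrt_divide algebra_simps)
    finally show ?thesis by simp
  qed
  define A B where "A = (\<lambda>w. a + b * w + w\<^sup>2 * r1 w)" and "B = (\<lambda>w. a + 2 * b * w + w\<^sup>2 * r2 w)"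
  have id: "((\<lambda>w. w) \<longlongrightarrow> 0) (at_right (0::real))" by (rule tendsto_ident_at)
  have "(A \<longlongrightarrow> a + b * 0 + 0\<^sup>2 * l1) (at_right 0)" "(B \<longlongrightarrow> a + 2 * b * 0 + 0\<^sup>2 * l2) (at_right 0)"
    unfolding A_def B_def by (intro tendsto_intros r id)+
  then have AB: "(A \<longlongrightarrow> a) (at_right 0)" "(B \<longlongrightarrow> a) (at_right 0)" by simp_all
  let ?X = "\<lambda>w. (b + 2 * r1 w - 2 * r2 w + w * r1 w - 2 * k * (a * (2 * b + w * r2 w) + (b + w * r1 w) * B w)) / (2 * (A w)\<^sup>2 * B w)"
  let ?L = "(b + 2 * l1 - 2 * l2 + 0 * l1 - 2 * k * (a * (2 * b + 0 * l2) + (b + 0 * l1) * a)) / (2 * a\<^sup>2 * a)"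
  have "(?X \<longlongrightarrow> ?L) (at_right 0)"
    using a by (intro tendsto_intros r id AB) auto
  moreover have "\<forall>\<^sub>F w in at_right 0. ?X w = grazing_curve w - 1 / (grazing.psi w)\<^sup>2 - 1 / sqrt pi * (1 / grazing.psi w)"
    using order_tendstoD(1)[OF AB(1) a] order_tendstoD(1)[OF AB(2) a] eventually_at_right_less[of "0::real"]
  proof eventually_elim
    case (elim w)
    then show ?case
      using grazing_curve_remainder[of w a b "r1 w" "r2 w" k] r(1,2)[of w] k
      by (simp only: grazing_curve_def A_def B_def k_def)
  qed
  ultimately have "((\<lambda>w. grazing_curve w - 1 / (grazing.psi w)\<^sup>2 - 1 / sqrt pi * (1 / grazing.psi w)) \<longlongrightarrow> ?L) (at_right 0)"
    by (rule Lim_transform_eventually)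
  then show ?thesis
    by (rule that)
qed

lemma grazing_kernel_remainder:
  obtains \<Phi>\<^sub>0 where "continuous_on {0..} \<Phi>\<^sub>0"
    "\<And>y. y > 0 \<Longrightarrow> grazing_kernel y = 1 / y\<^sup>2 + 1 / sqrt pi * (1 / y) + \<Phi>\<^sub>0 y"
proof -
  obtain L where "((\<lambda>w. grazing_curve w - 1 / (grazing.psi w)\<^sup>2 - 1 / sqrt pi * (1 / grazing.psi w)) \<longlongrightarrow> L) (at_right 0)"
    by (rule grazing_curve_at_0)
  from filterlim_compose[OF this filterlim_grazing_inv_at_right_0]
  have lim: "((\<lambda>y. grazing_kernel y - 1 / (grazing.psi (grazing_inv y))\<^sup>2 - 1 / sqrt pi * (1 / grazing.psi (grazing_inv y))) \<longlongrightarrow> L) (at_right 0)"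
    by (simp only: grazing_kernel_def)
  let ?h = "\<lambda>y. grazing_kernel y - 1 / y\<^sup>2 - 1 / sqrt pi * (1 / y)"
  define \<Phi>\<^sub>0 where "\<Phi>\<^sub>0 = (\<lambda>y. if y = 0 then L else ?h y)"
  have "\<forall>\<^sub>F y in at_right 0. grazing_kernel y - 1 / (grazing.psi (grazing_inv y))\<^sup>2 - 1 / sqrt pi * (1 / grazing.psi (grazing_inv y)) = \<Phi>\<^sub>0 y"
    using eventually_at_right_less[of "0::real"]
    by eventually_elim (simp add: \<Phi>\<^sub>0_def grazing_inv(2))
  with lim have lim0: "(\<Phi>\<^sub>0 \<longlongrightarrow> \<Phi>\<^sub>0 0) (at_right 0)"
    unfolding \<Phi>\<^sub>0_def by (simp add: Lim_transform_eventually)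
  show ?thesis
  proof (rule that)
    show "continuous_on {0..} \<Phi>\<^sub>0"
      unfolding continuous_on_def
    proof
      fix y :: real assume "y \<in> {0..}"
      then consider "y = 0" | "y > 0" by fastforce
      then show "(\<Phi>\<^sub>0 \<longlongrightarrow> \<Phi>\<^sub>0 y) (at y within {0..})"
      proof cases
        case 1
        then show ?thesis using lim0 by (simp add: at_within_Ici_at_right)
      next
        case 2
        then have cont: "isCont ?h y"
          by (intro continuous_intros isCont_grazing_kernel) auto
        have "\<forall>\<^sub>F v in nhds y. ?h v = \<Phi>\<^sub>0 v"
          using eventually_nhds_in_open[OF open_greaterThan, of y 0] 2
          by (simp add: eventually_mono \<Phi>\<^sub>0_def)
        from iffD1[OF isCont_cong[OF this] cont] show ?thesis
          unfolding isCont_def by (rule tendsto_within_subset) simp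
      qed
    qed
    show "grazing_kernel y = 1 / y\<^sup>2 + 1 / sqrt pi * (1 / y) + \<Phi>\<^sub>0 y" if "y > 0" for y
      using that by (simp add: \<Phi>\<^sub>0_def)
  qed
qed

section \<open>The grazing limit of the angular kernel\<close>

theorem theorem3:
  shows "\<exists>\<Phi> :: real \<Rightarrow> real.
    real_analytic_on \<Phi> {0<..} \<and>
    (\<forall>K. compact K \<and> K \<subseteq> {0<..} \<longrightarrow>
      uniform_limit K (\<lambda>s \<psi>. angular_kernel s (cos (\<psi> / sqrt s))) \<Phi> at_top) \<and>
    (\<Phi> \<longlongrightarrow> 1 / 4) at_top \<and>
    (\<exists>\<Phi>\<^sub>0 :: real \<Rightarrow> real.
      continuous_on {0..} \<Phi>\<^sub>0 \<and>
      (\<forall>\<psi>\<in>{0<..}. \<Phi> \<psi> = 1 / \<psi>\<^sup>2 + 1 / sqrt pi * (1 / \<psi>) + \<Phi>\<^sub>0 \<psi>))"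
proof (rule exI[of _ grazing_kernel], intro conjI allI impI)
  show "real_analytic_on grazing_kernel {0<..}"
    by (rule grazing_kernel_analytic)
  show "uniform_limit K (\<lambda>s \<psi>. angular_kernel s (cos (\<psi> / sqrt s))) grazing_kernel at_top"
    if K: "compact K \<and> K \<subseteq> {0<..}" for K
  proof (rule uniform_limit_compactI_sequentially)
    show "continuous_on K grazing_kernel"
      using K by (intro continuous_at_imp_continuous_on ballI isCont_grazing_kernel) auto
  next
    fix S X :: "nat \<Rightarrow> real" and x
    assume "filterlim S at_top sequentially" "X \<longlonglongrightarrow> x" "x \<in> K"
    then show "(\<lambda>k. angular_kernel (S k) (cos (X k / sqrt (S k)))) \<longlonglongrightarrow> grazing_kernel x"
      using K by (intro angular_kernel_tendsto) auto
  qed (use K in simp)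
  show "(grazing_kernel \<longlongrightarrow> 1 / 4) at_top"
    by (rule grazing_kernel_at_top)
  obtain \<Phi>\<^sub>0 where "continuous_on {0..} \<Phi>\<^sub>0"
    "\<And>y. y > 0 \<Longrightarrow> grazing_kernel y = 1 / y\<^sup>2 + 1 / sqrt pi * (1 / y) + \<Phi>\<^sub>0 y"
    using grazing_kernel_remainder by blast
  then show "\<exists>\<Phi>\<^sub>0 :: real \<Rightarrow> real. continuous_on {0..} \<Phi>\<^sub>0 \<and>
      (\<forall>\<psi>\<in>{0<..}. grazing_kernel \<psi> = 1 / \<psi>\<^sup>2 + 1 / sqrt pi * (1 / \<psi>) + \<Phi>\<^sub>0 \<psi>)"
    by auto
qed

end
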